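(* Let $\Lambda\ge\lambda>0$, $\theta_0\in(0,\pi)$, $\mathcal C_0=\{(x,y)\in\mathbb R^2: y>\cos(\theta_0)\sqrt{x^2+y^2}\}$, and let $u_{\alpha^\pm}=\rho^{\alpha^\pm}\phi_{\alpha^\pm}(\theta)$, with $\alpha^-<0<\alpha^+$, be the positive homogeneous solutions of $\mathcal M^-_{\lambda,\Lambda}(D^2u)=0$ in $\mathcal C_0$, $u=0$ on $\partial\mathcal C_0\setminus\{0\}$, described in the context. Let $u:\overline{\mathcal C_0}\to[0,+\infty]$ be a lower semicontinuous (viscosity) solution of $\mathcal M^-_{\lambda,\Lambda}(D^2u)\le0$ in $\mathcal C_0$, and for $r>0$ define $$m^\pm(r)=\inf_{\partial B_r\cap\mathcal C_0}\frac{u}{\phi_{\alpha^\pm}}.$$ Then $$r\in(0,+\infty)\mapsto r^{-\alpha^+}m^+(r)\ \text{ is non-increasing},$$ $$r\in(0,+\infty)\mapsto r^{-\alpha^-}m^-(r)\ \text{ is non-decreasing}.$$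
   Context: For a symmetric real matrix $M$ with eigenvalues $\mu_i$ (counted with multiplicity), $\mathcal M^-_{\lambda,\Lambda}(M)=\lambda\sum_{\mu_i>0}\mu_i+\Lambda\sum_{\mu_i<0}\mu_i$. $B_r$ is the open disc of radius $r$ centered at the origin; $\rho=\sqrt{x^2+y^2}$, $\theta=\arccos(y/\rho)$. Let $\omega=\Lambda/\lambda$ and write $A=\alpha-1+\frac1\omega$, $B=\alpha-1+\omega$. For $\alpha\in(-\infty,1-\omega)\cup(1-\frac1\omega,+\infty)$ let $G_{\omega,\alpha}$ be the strictly increasing function on $[0,1]$ given by - if $\alpha\ge1$: $G_{\omega,\alpha}(x)=\arctan(\sqrt\omega\,x)+\frac{2-\alpha}{\sqrt{AB}}\arctan\left(\sqrt{\frac{\omega A}{B}}\,x\right)$; - if $1-\frac1\omega<\alpha<1$: $G_{\omega,\alpha}(x)=\arctan\left(\frac{x}{\sqrt\omega}\right)+\frac{2-\alpha}{\sqrt{AB}}\arctan\left(\sqrt{\frac{B}{\omega A}}\,x\right)$; - if $\alpha<1-\omega$: $G_{\omega,\alpha}(x)=-\arctan(\sqrt\omega\,x)+\frac{2-\alpha}{\sqrt{AB}}\arctan\left(\sqrt{\frac{\omega A}{B}}\,x\right)$; and let $g_\omega(\alpha)=G_{\omega,\alpha}(1)>0$. The function $g_\omega$ is strictly increasing on $(-\infty,1-\omega)$ and strictly decreasing on $(1-\frac1\omega,+\infty)$, and $\alpha^-<0<\alpha^+$ are the exponents with $g_\omega(\alpha^\pm)=\theta_0$. The functions $\phi_{\alpha^\pm}$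 on $[0,\theta_0]$ are, with $\alpha=\alpha^\pm$ and $X=G_{\omega,\alpha}^{-1}(\theta)$, $$\phi_\alpha(\theta)=\frac{(1-X^2)\left(1+\frac{\omega A}{B}X^2\right)^{\frac{\alpha-2}{2}}}{(1+\omega X^2)^{\alpha/2}}$$ if $\alpha=\alpha^-$, or if $\alpha=\alpha^+$ and $\theta_0\le\pi/2$, and $$\phi_\alpha(\theta)=\frac{(1-X^2)\left(1+\frac{B}{\omega A}X^2\right)^{\frac{\alpha-2}{2}}}{(1+\frac1\omega X^2)^{\alpha/2}}$$ if $\alpha=\alpha^+$ and $\theta_0>\pi/2$. These $u_{\alpha^\pm}=\rho^{\alpha^\pm}\phi_{\alpha^\pm}(\theta)$ are, up to positive constant factors, the positive homogeneous solutions of $\mathcal M^-_{\lambda,\Lambda}(D^2u)=0$ in $\mathcal C_0$, $u=0$ on $\partial\mathcal C_0\setminus\{0\}$. *)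

theory Defs
  imports "HOL-Analysis.Analysis" "HOL-Computational_Algebra.Polynomial"
begin

section \<open>The Pucci operator\<close>

definition charpoly :: "real^'n^'n \<Rightarrow> real poly" where
  "charpoly M = det (\<chi> i j. (if i = j then [:0, 1:] else 0) - [:M $ i $ j:])"

text \<open>\<^const>\<open>proots\<close> repeats each root according to its order; for symmetric \<open>M\<close> this
  multiset has \<open>CARD('n)\<close> elements.\<close>

definition eigenvalues :: "real^'n^'n \<Rightarrow> real multiset" where
  "eigenvalues M = proots (charpoly M)"

definition pucci_minus :: "real \<Rightarrow> real \<Rightarrow> real^'n^'n \<Rightarrow> real" where
  "pucci_minus lam Lam M =
     lam * (\<Sum>\<mu>\<in>#{#\<mu> \<in># eigenvalues M. \<mu> > 0#}. \<mu>)
     + Lam * (\<Sum>\<mu>\<in>#{#\<mu> \<in># eigenvalues M. \<mu> < 0#}. \<mu>)"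


section \<open>Viscosity supersolutions\<close>

definition lsc_on :: "'a::topological_space set \<Rightarrow> ('a \<Rightarrow> ereal) \<Rightarrow> bool" where
  "lsc_on S u \<longleftrightarrow> (\<forall>x\<in>S. u x \<le> Liminf (at x within S) u)"

text \<open>\<open>\<psi>\<close> is of class \<open>C\<^sup>2\<close> on the open set \<open>N\<close>, with gradient \<open>g\<close> and Hessian matrix \<open>H\<close>.\<close>

definition C2_with :: "(real^'n) set \<Rightarrow> (real^'n \<Rightarrow> real) \<Rightarrow> (real^'n \<Rightarrow> real^'n)
    \<Rightarrow> (real^'n \<Rightarrow> real^'n^'n) \<Rightarrow> bool" where
  "C2_with N \<psi> g H \<longleftrightarrow> open N \<and>
     (\<forall>x\<in>N. GDERIV \<psi> x :> g x) \<and>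
     (\<forall>x\<in>N. (g has_derivative (\<lambda>h. H x *v h)) (at x)) \<and>
     continuous_on N H"

text \<open>\<open>F (D\<^sup>2u) \<le> 0\<close> in \<open>U\<close>. A test function touches \<open>u\<close> from below at \<open>x\<close>; being real-valued, it
  never does so where \<open>u = \<infinity>\<close>.\<close>

definition viscosity_supersolution ::
  "(real^'n^'n \<Rightarrow> real) \<Rightarrow> (real^'n) set \<Rightarrow> (real^'n \<Rightarrow> ereal) \<Rightarrow> bool" where
  "viscosity_supersolution F U u \<longleftrightarrow>
     (\<forall>x N \<psi> g H. x \<in> N \<and> N \<subseteq> U \<and> C2_with N \<psi> g H \<and>
        u x = ereal (\<psi> x) \<and> (\<forall>y\<in>N. ereal (\<psi> y) \<le> u y)
        \<longrightarrow> F (H x) \<le> 0)"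


section \<open>The cone and its homogeneous solutions\<close>

definition cone_C0 :: "real \<Rightarrow> (real^2) set" where
  "cone_C0 \<theta>0 = {z. z $ 2 > cos \<theta>0 * sqrt ((z $ 1)\<^sup>2 + (z $ 2)\<^sup>2)}"

definition polar_angle :: "real^2 \<Rightarrow> real" where
  "polar_angle z = arccos (z $ 2 / sqrt ((z $ 1)\<^sup>2 + (z $ 2)\<^sup>2))"

definition A_coef :: "real \<Rightarrow> real \<Rightarrow> real" where
  "A_coef \<omega> \<alpha> = \<alpha> - 1 + 1 / \<omega>"

definition B_coef :: "real \<Rightarrow> real \<Rightarrow> real" where
  "B_coef \<omega> \<alpha> = \<alpha> - 1 + \<omega>"

definition exponent_dom :: "real \<Rightarrow> real set" where
  "exponent_dom \<omega> = {..< 1 - \<omega>} \<union> {1 - 1 / \<omega> <..}"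

text \<open>Meaningful for \<open>\<omega> \<ge> 1\<close> and \<open>\<alpha> \<in> exponent_dom \<omega>\<close>; the last branch is then \<open>\<alpha> < 1 - \<omega>\<close>,
  where both coefficients are negative.\<close>

definition G_fun :: "real \<Rightarrow> real \<Rightarrow> real \<Rightarrow> real" where
  "G_fun \<omega> \<alpha> x =
     (let A = A_coef \<omega> \<alpha>; B = B_coef \<omega> \<alpha>; c = (2 - \<alpha>) / sqrt (A * B) in
      if \<alpha> \<ge> 1 then
        arctan (sqrt \<omega> * x) + c * arctan (sqrt (\<omega> * A / B) * x)
      else if 1 - 1 / \<omega> < \<alpha> then
        arctan (x / sqrt \<omega>) + c * arctan (sqrt (B / (\<omega> * A)) * x)
      else
        - arctan (sqrt \<omega> * x) + c * arctan (sqrt (\<omega> * A / B) * x))"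

definition g_fun :: "real \<Rightarrow> real \<Rightarrow> real" where
  "g_fun \<omega> \<alpha> = G_fun \<omega> \<alpha> 1"

definition G_inv :: "real \<Rightarrow> real \<Rightarrow> real \<Rightarrow> real" where
  "G_inv \<omega> \<alpha> = inv_into {0..1} (G_fun \<omega> \<alpha>)"

definition phi1 :: "real \<Rightarrow> real \<Rightarrow> real \<Rightarrow> real" where
  "phi1 \<omega> \<alpha> \<theta> =
     (let A = A_coef \<omega> \<alpha>; B = B_coef \<omega> \<alpha>; X = G_inv \<omega> \<alpha> \<theta> in
      (1 - X\<^sup>2) * (1 + \<omega> * A / B * X\<^sup>2) powr ((\<alpha> - 2) / 2) / (1 + \<omega> * X\<^sup>2) powr (\<alpha> / 2))"

definition phi2 :: "real \<Rightarrow> real \<Rightarrow> real \<Rightarrow> real" where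
  "phi2 \<omega> \<alpha> \<theta> =
     (let A = A_coef \<omega> \<alpha>; B = B_coef \<omega> \<alpha>; X = G_inv \<omega> \<alpha> \<theta> in
      (1 - X\<^sup>2) * (1 + B / (\<omega> * A) * X\<^sup>2) powr ((\<alpha> - 2) / 2) / (1 + 1 / \<omega> * X\<^sup>2) powr (\<alpha> / 2))"

definition phi_minus :: "real \<Rightarrow> real \<Rightarrow> real \<Rightarrow> real" where
  "phi_minus \<omega> \<alpha> = phi1 \<omega> \<alpha>"

definition phi_plus :: "real \<Rightarrow> real \<Rightarrow> real \<Rightarrow> real \<Rightarrow> real" where
  "phi_plus \<omega> \<theta>0 \<alpha> = (if \<theta>0 \<le> pi / 2 then phi1 \<omega> \<alpha> else phi2 \<omega> \<alpha>)"

definition circle_inf :: "real \<Rightarrow> (real \<Rightarrow> real) \<Rightarrow> (real^2 \<Rightarrow> ereal) \<Rightarrow> real \<Rightarrow> ereal" where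
  "circle_inf \<theta>0 \<phi> u r = (INF z \<in> sphere 0 r \<inter> cone_C0 \<theta>0. u z / ereal (\<phi> (polar_angle z)))"

end

theory Submission
  imports Defs
begin

text \<open>Let \<open>V = \<rho>\<^sup>\<alpha> \<phi>\<^sub>\<alpha>(\<theta>)\<close>. Parametrised by \<open>X\<close>, the profile, its angular derivatives and hence the
  Hessian of \<open>V\<close> are explicit, with eigenvalues proportional to \<open>- 1\<close> and \<open>k\<close>, where \<open>k\<close> is \<open>\<omega>\<close> or
  \<open>1/\<omega>\<close>, in such a way that the Pucci operator vanishes. Adding \<open>\<epsilon>|z|\<^sup>2\<close> makes \<open>V\<close> a strict classical
  subsolution, which a lower semicontinuous supersolution can touch from above only on the boundary.
  For \<open>\<alpha> > 0\<close>, \<open>V\<close> vanishes at the apex, so a bound \<open>u \<ge> c V\<close> on a circle propagates to the enclosed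
  sector; for \<open>\<alpha> < 0\<close>, \<open>V\<close> vanishes at infinity and the bound propagates to the exterior. These two
  propagations are the two monotonicity claims.\<close>

section \<open>Comparison with strict classical subsolutions\<close>

text \<open>Why \<open>k\<close> has two values: the eigenvalues are proportional to -n and k n,
  where n has the sign of \<alpha>(\<alpha> - 1). The positive one is weighted by
  \<open>lam\<close>, the negative one by \<open>Lam\<close>, so the operator vanishes for n > 0 iff
  \<open>k * lam = Lam\<close> and for n < 0 iff \<open>k * Lam = lam\<close>. Hence
  \<open>k\<close> is \<omega> for \<alpha> outside (0, 1) and 1/\<omega> inside, which is the
  origin of the two formulas for the profile.

  V alone gives the operator the value 0, which a supersolution tolerates at a contact point; the
  quadratic term excludes this. On a piece of radius R it is offset by the constant -\<epsilon> R^2,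
  and \<epsilon> tends to 0 afterwards.

  The infimum enters only through an equivalence: for real c \<ge> 0, the infimum on the circle of
  radius r is at least c r^\<alpha> iff u \<ge> c V on that circle. Infinite values of u or of the
  infimum thus need no arithmetic.

  The profile is known only through the inverse of G. Since the derivative of G is an explicit
  quotient without arctangents, differentiation in the angle becomes differentiation in X followed
  by division by it.\<close>

lemma eigenvalues_2x2:
  fixes M :: "real^2^2"
  assumes "M $ 1 $ 1 + M $ 2 $ 2 = p + q"
    and "M $ 1 $ 1 * M $ 2 $ 2 - M $ 1 $ 2 * M $ 2 $ 1 = p * q"
  shows "eigenvalues M = {#p, q#}"
proof -
  have "charpoly M = [:M $ 1 $ 1 * M $ 2 $ 2 - M $ 1 $ 2 * M $ 2 $ 1, - (M $ 1 $ 1 + M $ 2 $ 2), 1:]"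
    by (simp add: charpoly_def det_2)
  also have "\<dots> = [:- p, 1:] * [:- q, 1:]"
    by (simp only: assms) simp
  finally have "eigenvalues M = proots [:- p, 1:] + proots [:- q, 1:]"
    unfolding eigenvalues_def by (simp add: proots_mult del: mult_pCons_left mult_pCons_right proots_linear_factor)
  then show ?thesis by simp
qed

lemma pucci_minus_2x2:
  fixes M :: "real^2^2"
  assumes "M $ 1 $ 1 + M $ 2 $ 2 = p + q"
    and "M $ 1 $ 1 * M $ 2 $ 2 - M $ 1 $ 2 * M $ 2 $ 1 = p * q"
  shows "pucci_minus lam Lam M
    = (lam * max p 0 + Lam * min p 0) + (lam * max q 0 + Lam * min q 0)"
  by (simp add: pucci_minus_def eigenvalues_2x2[OF assms] algebra_simps)

text \<open>If there is no minimum, every x has a strictly lower competitor \<open>y x\<close>,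
  which by semicontinuity lies below h on a whole neighbourhood \<open>T x\<close>. Among finitely
  many such sets covering K, the lowest competitor lies in one of them and is undercut. Only the
  order of values is used, so infinite ones are allowed.\<close>

lemma lsc_attains_inf:
  fixes h :: "'a::topological_space \<Rightarrow> ereal"
  assumes "compact K" "K \<noteq> {}" "lsc_on K h"
  shows "\<exists>x\<in>K. \<forall>y\<in>K. h x \<le> h y"
proof (rule ccontr)
  assume "\<not> ?thesis"
  then have "\<forall>x\<in>K. \<exists>y\<in>K. h y < h x" by (auto simp: not_le)
  then obtain y where y: "\<And>x. x \<in> K \<Longrightarrow> y x \<in> K" "\<And>x. x \<in> K \<Longrightarrow> h (y x) < h x" by metis
  have "\<exists>T. open T \<and> x \<in> T \<and> (\<forall>z\<in>T \<inter> K. h (y x) < h z)" if "x \<in> K" for x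
  proof -
    have "h x \<le> Liminf (at x within K) h" using assms(3) that by (simp add: lsc_on_def)
    with y(2)[OF that] have "eventually (\<lambda>z. h (y x) < h z) (at x within K)"
      by (simp add: le_Liminf_iff)
    \<comment> \<open>\<open>at x within K\<close> omits x itself, where the inequality is
      \<open>y(2)\<close>.\<close>
    with y(2)[OF that] show ?thesis by (auto simp: eventually_at_topological)
  qed
  then obtain T where T: "\<And>x. x \<in> K \<Longrightarrow> open (T x)" "\<And>x. x \<in> K \<Longrightarrow> x \<in> T x"
    "\<And>x z. x \<in> K \<Longrightarrow> z \<in> T x \<Longrightarrow> z \<in> K \<Longrightarrow> h (y x) < h z" by (metis IntI)
  have "K \<subseteq> (\<Union>x\<in>K. T x)" using T(2) by blast
  then obtain D where D: "D \<subseteq> K" "finite D" "K \<subseteq> (\<Union>x\<in>D. T x)"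
    using compactE_image[OF assms(1), of K T] T(1) by metis
  have "D \<noteq> {}" using D assms(2) by auto
  then have "Min ((\<lambda>x. h (y x)) ` D) \<in> (\<lambda>x. h (y x)) ` D" using D by simp
  then obtain a where a: "a \<in> D" "Min ((\<lambda>x. h (y x)) ` D) = h (y a)" by auto
  have "y a \<in> K" using a D y by auto
  then obtain b where b: "b \<in> D" "y a \<in> T b" using D by blast
  then have "h (y b) < h (y a)" using T(3) D \<open>y a \<in> K\<close> by blast
  moreover have "h (y a) \<le> h (y b)" using a b D by (metis Min_le finite_imageI imageI)
  ultimately show False by simp
qed

lemma lsc_on_minus_continuous:
  assumes "lsc_on K u" "continuous_on K \<psi>" "\<And>x. x \<in> K \<Longrightarrow> u x \<noteq> - \<infinity>"
  shows "lsc_on K (\<lambda>x. u x - ereal (\<psi> x))"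
  unfolding lsc_on_def le_Liminf_iff
proof (intro ballI allI impI)
  fix x a assume x: "x \<in> K" and a: "a < u x - ereal (\<psi> x)"
  have K: "eventually (\<lambda>z. z \<in> K) (at x within K)" by (simp add: eventually_at_filter)
  show "eventually (\<lambda>z. a < u z - ereal (\<psi> z)) (at x within K)"
  proof (cases a)
    case (real r)
    then have "ereal (r + \<psi> x) < u x" using a by (cases "u x") auto
    then obtain b where b: "ereal (r + \<psi> x) < ereal b" "ereal b < u x" using ereal_dense2 by blast
    have "eventually (\<lambda>z. ereal b < u z) (at x within K)"
      using assms(1) x b(2) by (auto simp: lsc_on_def le_Liminf_iff)
    moreover have "eventually (\<lambda>z. \<psi> z < b - r) (at x within K)"
      using assms(2) x b(1) by (intro order_tendstoD(2)) (auto simp: continuous_on_def)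
    ultimately show ?thesis
    proof eventually_elim
      case (elim z) then show ?case using real by (cases "u z") auto
    qed
  next
    case PInf then show ?thesis using a by auto
  next
    case MInf
    show ?thesis using K
    proof eventually_elim
      case (elim z) then show ?case using assms(3)[OF elim] MInf by (cases "u z") auto
    qed
  qed
qed

lemma C2_with_add_const:
  assumes "C2_with N \<psi> g H" shows "C2_with N (\<lambda>x. \<psi> x + d) g H"
  using assms unfolding C2_with_def gderiv_def by (simp add: has_derivative_add_const)

lemma viscosity_supersolution_subset:
  assumes "viscosity_supersolution F V u" "U \<subseteq> V"
  shows "viscosity_supersolution F U u"
  unfolding viscosity_supersolution_def
proof (intro allI impI, elim conjE)
  fix x N \<psi> g H
  assume N: "x \<in> N" "N \<subseteq> U" "C2_with N \<psi> g H" "u x = ereal (\<psi> x)" "\<forall>y\<in>N. ereal (\<psi> y) \<le> u y"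
  have "N \<subseteq> V" using N(2) assms(2) by (rule subset_trans)
  with N show "F (H x) \<le> 0"
    by (intro assms(1)[unfolded viscosity_supersolution_def, rule_format, of x N \<psi> g H] conjI)
qed

text \<open>A negative minimum of u - \<psi> over the closure is finite and, by the boundary
  condition, attained inside U. There \<psi> plus a constant is itself an admissible test function
  with Hessian \<open>H\<close>, against strictness.\<close>

lemma viscosity_comparison:
  assumes U: "bounded U"
    and u: "viscosity_supersolution F U u" "lsc_on (closure U) u"
      "\<And>x. x \<in> closure U \<Longrightarrow> u x \<noteq> - \<infinity>"
    and \<psi>: "C2_with U \<psi> g H" "continuous_on (closure U) \<psi>"
      "\<And>x. x \<in> U \<Longrightarrow> F (H x) > 0"
    and bdry: "\<And>x. x \<in> closure U - U \<Longrightarrow> ereal (\<psi> x) \<le> u x"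
    and z: "z \<in> U"
  shows "ereal (\<psi> z) \<le> u z"
proof (rule ccontr)
  assume less: "\<not> ?thesis"
  have zc: "z \<in> closure U" using z closure_subset by blast
  have "compact (closure U)" using U by simp
  moreover have "lsc_on (closure U) (\<lambda>x. u x - ereal (\<psi> x))"
    using u(2) \<psi>(2) u(3) by (rule lsc_on_minus_continuous)
  moreover have "closure U \<noteq> {}" using zc by (metis empty_iff)
  ultimately have "\<exists>x\<in>closure U. \<forall>y\<in>closure U. u x - ereal (\<psi> x) \<le> u y - ereal (\<psi> y)"
    by (intro lsc_attains_inf)
  then obtain x where x: "x \<in> closure U"
    and min: "\<And>y. y \<in> closure U \<Longrightarrow> u x - ereal (\<psi> x) \<le> u y - ereal (\<psi> y)" by (elim bexE) simp
  have "u x - ereal (\<psi> x) \<le> u z - ereal (\<psi> z)" using min zc by blast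
  then have neg: "u x < ereal (\<psi> x)" using less by (cases "u x"; cases "u z") auto
  then obtain d where d: "u x = ereal d" using u(3)[OF x] by (cases "u x") auto
  have xU: "x \<in> U" using bdry[of x] x neg by force
  \<comment> \<open>The minimum is global, so all of U serves as the neighbourhood on which the test
    function stays below u.\<close>
  have "ereal (\<psi> y + (d - \<psi> x)) \<le> u y" if "y \<in> U" for y
  proof -
    have "y \<in> closure U" using that closure_subset by blast
    from min[OF this] show ?thesis using d by (cases "u y") auto
  qed
  then have "F (H x) \<le> 0"
    using u(1)[unfolded viscosity_supersolution_def, rule_format,
        of x U "\<lambda>y. \<psi> y + (d - \<psi> x)" g H] xU C2_with_add_const[OF \<psi>(1)] d by simp
  then show False using \<psi>(3)[OF xU] by simp
qed

section \<open>Hessians in polar coordinates\<close>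

lemma C2_with_scale_add_quadratic:
  assumes "C2_with N \<psi> g H"
  shows "C2_with N (\<lambda>x. c * \<psi> x + e * (x \<bullet> x) + d) (\<lambda>x. c *\<^sub>R g x + (2 * e) *\<^sub>R x)
    (\<lambda>x. c *\<^sub>R H x + mat (2 * e))"
proof -
  have H: "continuous_on N H" and N: "open N" using assms by (auto simp: C2_with_def)
  have "((\<lambda>x. c * \<psi> x + e * (x \<bullet> x) + d) has_derivative (\<lambda>h. h \<bullet> (c *\<^sub>R g x + (2 * e) *\<^sub>R x))) (at x)"
    if "x \<in> N" for x
  proof -
    have "(\<psi> has_derivative (\<lambda>h. h \<bullet> g x)) (at x)"
      using assms that by (simp add: C2_with_def gderiv_def)
    note [derivative_intros] = this
    show ?thesis
      by (rule derivative_eq_intros refl)+ (simp add: inner_add_right inner_commute algebra_simps)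
  qed
  moreover have "((\<lambda>x. c *\<^sub>R g x + (2 * e) *\<^sub>R x) has_derivative (\<lambda>h. (c *\<^sub>R H x + mat (2 * e)) *v h)) (at x)"
    if "x \<in> N" for x
  proof -
    have "(g has_derivative (\<lambda>h. H x *v h)) (at x)"
      using assms that by (simp add: C2_with_def)
    note [derivative_intros] = this
    have "mat (2 * e) *v h = (2 * e) *\<^sub>R h" for h :: "real^'a"
      by (simp add: vec_eq_iff matrix_vector_mult_def mat_def if_distrib[of "\<lambda>x. x * _"] cong: if_cong)
    then show ?thesis
      by - ((rule derivative_eq_intros refl)+,
        simp add: matrix_vector_mult_add_rdistrib scaleR_matrix_vector_assoc)
  qed
  moreover have "continuous_on N (\<lambda>x. c *\<^sub>R H x + mat (2 * e))"
    by (intro continuous_intros H)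
  ultimately show ?thesis using N unfolding C2_with_def gderiv_def by blast
qed

text \<open>The swap of coordinates measures the argument from the vertical axis and puts the branch
  cut of \<open>Ln\<close> on the negative vertical half-axis, outside every cone with \<theta>0 <
  \<pi>.\<close>

definition cplane :: "real^2 \<Rightarrow> complex" where
  "cplane z = Complex (z $ 2) (z $ 1)"

text \<open>The signed angle from the vertical axis. Unlike its absolute value \<open>polar_angle\<close>, it is smooth
  across the axis.\<close>

definition ang :: "real^2 \<Rightarrow> real" where
  "ang z = Im (Ln (cplane z))"

lemma inner_real2: "(z :: real^2) \<bullet> w = z $ 1 * w $ 1 + z $ 2 * w $ 2"
  by (simp add: inner_vec_def sum_2)

lemma bounded_linear_cplane: "bounded_linear cplane"
proof -
  have "cplane = (\<lambda>z. of_real (z $ 2) + \<i> * of_real (z $ 1))"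
    by (auto simp: cplane_def complex_eq_iff)
  moreover have "bounded_linear (\<lambda>z::real^2. of_real (z $ 2) + \<i> * of_real (z $ 1))"
    by (intro bounded_linear_intros bounded_linear_compose[OF bounded_linear_of_real]
        bounded_linear_compose[OF bounded_linear_mult_right] bounded_linear_add
        bounded_linear_vec_nth)
  ultimately show ?thesis by simp
qed

lemma norm_cplane: "norm (cplane z) = norm z"
  by (simp add: cplane_def norm_vec_def cmod_def L2_set_def sum_2 add.commute)

lemma has_derivative_ang:
  assumes "cplane z \<notin> \<real>\<^sub>\<le>\<^sub>0"
  shows "(ang has_derivative (\<lambda>h. (h $ 1 * z $ 2 - h $ 2 * z $ 1) / (z \<bullet> z))) (at z)"
proof -
  have "(Ln has_derivative (\<lambda>w. inverse (cplane z) * w)) (at (cplane z))"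
    using has_field_derivative_Ln[OF assms] by (simp add: has_field_derivative_def)
  from has_derivative_compose[OF bounded_linear_imp_has_derivative[OF bounded_linear_cplane] this]
  have "((\<lambda>z. Ln (cplane z)) has_derivative (\<lambda>h. inverse (cplane z) * cplane h)) (at z)" .
  from bounded_linear.has_derivative[OF bounded_linear_Im this]
  have "(ang has_derivative (\<lambda>h. Im (inverse (cplane z) * cplane h))) (at z)"
    by (simp add: ang_def[abs_def])
  moreover have "Im (inverse (cplane z) * cplane h) = (h $ 1 * z $ 2 - h $ 2 * z $ 1) / (z \<bullet> z)" for h
    by (simp add: cplane_def inner_real2 power2_eq_square add.commute diff_divide_distrib mult.commute)
  ultimately show ?thesis by simp
qed

lemma has_derivative_inner_self_powr:
  fixes z :: "'a::real_inner"
  assumes "z \<noteq> 0"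
  shows "((\<lambda>z. (z \<bullet> z) powr p) has_derivative (\<lambda>h. 2 * p * (z \<bullet> z) powr (p - 1) * (z \<bullet> h))) (at z)"
proof -
  have "z \<bullet> z > 0" using assms by simp
  then have 1: "((\<lambda>x. x powr p) has_derivative (\<lambda>h. p * (z \<bullet> z) powr (p - 1) * h)) (at (z \<bullet> z))"
    using has_real_derivative_powr[of "z \<bullet> z" p] by (simp add: has_field_derivative_def)
  have 2: "((\<lambda>z. z \<bullet> z) has_derivative (\<lambda>h. 2 * (z \<bullet> h))) (at z)"
    by (rule derivative_eq_intros refl)+ (simp add: inner_commute)
  from has_derivative_compose[OF 2 1] show ?thesis by (simp add: mult_ac)
qed

text \<open>The parameters \<open>a\<close>, \<open>b\<close>, \<open>d\<close> are the entries of the Hessian in the frame of radial and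
  angular unit vectors, up to the factor \<open>\<rho> powr (\<alpha> - 2)\<close>.\<close>

definition polar_hessian :: "real \<Rightarrow> real \<Rightarrow> real \<Rightarrow> real \<Rightarrow> real^2 \<Rightarrow> real^2^2" where
  "polar_hessian \<alpha> a b d z = (z \<bullet> z) powr (\<alpha> / 2 - 2) *\<^sub>R
     vector [vector [a * (z $ 1)\<^sup>2 + 2 * b * (z $ 1 * z $ 2) + d * (z $ 2)\<^sup>2,
                     (a - d) * (z $ 1 * z $ 2) + b * ((z $ 2)\<^sup>2 - (z $ 1)\<^sup>2)],
             vector [(a - d) * (z $ 1 * z $ 2) + b * ((z $ 2)\<^sup>2 - (z $ 1)\<^sup>2),
                     a * (z $ 2)\<^sup>2 - 2 * b * (z $ 1 * z $ 2) + d * (z $ 1)\<^sup>2]]"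

text \<open>The quarter turn towards increasing \<open>ang\<close>: \<open>rot z\<close> divided by
  \<open>z \<bullet> z\<close> is the gradient of \<open>ang\<close>.\<close>

definition rot :: "real^2 \<Rightarrow> real^2" where
  "rot z = vector [z $ 2, - z $ 1]"

lemma bounded_linear_rot: "bounded_linear rot"
  by (rule linear_conv_bounded_linear[THEN iffD1], rule linearI)
    (simp_all add: rot_def vec_eq_iff forall_2)

lemma continuous_on_vector_2:
  fixes f g :: "'a::topological_space \<Rightarrow> 'b::real_normed_vector"
  assumes "continuous_on S f" "continuous_on S g"
  shows "continuous_on S (\<lambda>x. vector [f x, g x] :: 'b^2)"
proof -
  have "(\<lambda>x. vector [f x, g x] :: 'b^2) = (\<lambda>x. \<chi> i. if i = 1 then f x else g x)"
    by (simp add: fun_eq_iff vec_eq_iff forall_2)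
  moreover have "continuous_on S (\<lambda>x. if i = 1 then f x else g x)" for i :: 2
    using assms by (cases "i = 1") auto
  ultimately show ?thesis by (simp only: continuous_on_vec_lambda)
qed

text \<open>The entries are the classical second derivatives of \<rho>^\<alpha> f(\<theta>) in the
  orthonormal polar frame: radial, mixed and angular.\<close>

lemma C2_with_polar:
  assumes N: "open N" "\<And>z. z \<in> N \<Longrightarrow> cplane z \<notin> \<real>\<^sub>\<le>\<^sub>0" and I: "open I" "ang ` N \<subseteq> I"
    and f: "\<And>t. t \<in> I \<Longrightarrow> (f has_real_derivative f1 t) (at t)"
      "\<And>t. t \<in> I \<Longrightarrow> (f1 has_real_derivative f2 t) (at t)"
      "continuous_on I f2"
  shows "C2_with N (\<lambda>z. (z \<bullet> z) powr (\<alpha> / 2) * f (ang z))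
    (\<lambda>z. (z \<bullet> z) powr (\<alpha> / 2 - 1) *\<^sub>R ((\<alpha> * f (ang z)) *\<^sub>R z + f1 (ang z) *\<^sub>R rot z))
    (\<lambda>z. polar_hessian \<alpha> (\<alpha> * (\<alpha> - 1) * f (ang z)) ((\<alpha> - 1) * f1 (ang z)) (f2 (ang z) + \<alpha> * f (ang z)) z)"
proof -
  have nz: "z \<noteq> 0" if "z \<in> N" for z
    using N(2)[OF that] by (auto simp: cplane_def complex_nonpos_Reals_iff)
  have f': "((\<lambda>z. f (ang z)) has_derivative (\<lambda>h. f1 (ang z) * ((h $ 1 * z $ 2 - h $ 2 * z $ 1) / (z \<bullet> z)))) (at z)"
    "((\<lambda>z. f1 (ang z)) has_derivative (\<lambda>h. f2 (ang z) * ((h $ 1 * z $ 2 - h $ 2 * z $ 1) / (z \<bullet> z)))) (at z)"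
    if "z \<in> N" for z
    using I(2) that by (intro has_derivative_compose[OF has_derivative_ang[OF N(2)[OF that]]]
        f(1,2)[unfolded has_field_derivative_def]; blast)+
  have ptw: "(z \<bullet> z) powr (p - 1) = (z \<bullet> z) powr (p - 2) * (z \<bullet> z)"
      "(z \<bullet> z) powr p = (z \<bullet> z) powr (p - 1) * (z \<bullet> z)" if "z \<in> N" for z and p :: real
  proof -
    have "z \<bullet> z > 0" using nz[OF that] by simp
    then show "(z \<bullet> z) powr (p - 1) = (z \<bullet> z) powr (p - 2) * (z \<bullet> z)"
      "(z \<bullet> z) powr p = (z \<bullet> z) powr (p - 1) * (z \<bullet> z)"
      using powr_add[of "z \<bullet> z" "p - 2" 1] powr_add[of "z \<bullet> z" "p - 1" 1] by (simp_all add: algebra_simps)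
  qed
  have 1: "((\<lambda>z. (z \<bullet> z) powr (\<alpha> / 2) * f (ang z)) has_derivative
     (\<lambda>h. h \<bullet> ((z \<bullet> z) powr (\<alpha> / 2 - 1) *\<^sub>R ((\<alpha> * f (ang z)) *\<^sub>R z + f1 (ang z) *\<^sub>R rot z)))) (at z)"
    if z: "z \<in> N" for z
  proof -
    have pos: "z \<bullet> z > 0" using nz[OF z] by simp
    define P where "P = (z \<bullet> z) powr (\<alpha> / 2 - 1)"
    have "((\<lambda>z. (z \<bullet> z) powr (\<alpha> / 2) * f (ang z)) has_derivative
      (\<lambda>h. P * (z \<bullet> z) * (f1 (ang z) * ((h $ 1 * z $ 2 - h $ 2 * z $ 1) / (z \<bullet> z)))
         + (\<alpha> * P * (z \<bullet> h)) * f (ang z))) (at z)"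
      using has_derivative_mult[OF has_derivative_inner_self_powr[OF nz[OF z], of "\<alpha> / 2"] f'(1)[OF z]]
      by (simp add: ptw(2)[OF z, of "\<alpha> / 2"] P_def)
    moreover have "P * (z \<bullet> z) * (f1 (ang z) * ((h $ 1 * z $ 2 - h $ 2 * z $ 1) / (z \<bullet> z)))
         + (\<alpha> * P * (z \<bullet> h)) * f (ang z) = h \<bullet> (P *\<^sub>R ((\<alpha> * f (ang z)) *\<^sub>R z + f1 (ang z) *\<^sub>R rot z))" for h
    proof -
      have "P * (z \<bullet> z) * (f1 (ang z) * ((h $ 1 * z $ 2 - h $ 2 * z $ 1) / (z \<bullet> z)))
        = P * f1 (ang z) * (h $ 1 * z $ 2 - h $ 2 * z $ 1)" using pos by (simp add: field_simps)
      then show ?thesis by (simp add: inner_real2 rot_def algebra_simps)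
    qed
    ultimately show ?thesis unfolding P_def by simp
  qed
  have 2: "((\<lambda>z. (z \<bullet> z) powr (\<alpha> / 2 - 1) *\<^sub>R ((\<alpha> * f (ang z)) *\<^sub>R z + f1 (ang z) *\<^sub>R rot z)) has_derivative
     (\<lambda>h. polar_hessian \<alpha> (\<alpha> * (\<alpha> - 1) * f (ang z)) ((\<alpha> - 1) * f1 (ang z)) (f2 (ang z) + \<alpha> * f (ang z)) z *v h)) (at z)"
    if z: "z \<in> N" for z
  proof -
    have pos: "z \<bullet> z > 0" using nz[OF z] by simp
    define P where "P = (z \<bullet> z) powr (\<alpha> / 2 - 2)"
    define D where "D h = (h $ 1 * z $ 2 - h $ 2 * z $ 1) / (z \<bullet> z)" for h :: "real^2"
    define F where "F = f (ang z)"
    define F1 where "F1 = f1 (ang z)"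
    define F2 where "F2 = f2 (ang z)"
    have d1: "((\<lambda>z. (z \<bullet> z) powr (\<alpha> / 2 - 1)) has_derivative (\<lambda>h. (\<alpha> - 2) * P * (z \<bullet> h))) (at z)"
      using has_derivative_inner_self_powr[OF nz[OF z], of "\<alpha> / 2 - 1"] by (simp add: P_def algebra_simps)
    have d2: "((\<lambda>z. f (ang z)) has_derivative (\<lambda>h. F1 * D h)) (at z)"
      and d3: "((\<lambda>z. f1 (ang z)) has_derivative (\<lambda>h. F2 * D h)) (at z)"
      using f'[OF z] by (auto simp: F1_def F2_def D_def)
    have d4: "(rot has_derivative rot) (at z)"
      by (rule bounded_linear_imp_has_derivative[OF bounded_linear_rot])
    note [derivative_intros] = d1 d2 d3 d4
    have "((\<lambda>z. (z \<bullet> z) powr (\<alpha> / 2 - 1) *\<^sub>R ((\<alpha> * f (ang z)) *\<^sub>R z + f1 (ang z) *\<^sub>R rot z)) has_derivative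
      (\<lambda>h. (P * (z \<bullet> z)) *\<^sub>R ((\<alpha> * F) *\<^sub>R h + (\<alpha> * (F1 * D h)) *\<^sub>R z + (F1 *\<^sub>R rot h + (F2 * D h) *\<^sub>R rot z))
         + ((\<alpha> - 2) * P * (z \<bullet> h)) *\<^sub>R ((\<alpha> * F) *\<^sub>R z + F1 *\<^sub>R rot z))) (at z)"
      by (rule derivative_eq_intros refl)+
        (simp add: ptw(1)[OF z, of "\<alpha> / 2"] P_def F_def F1_def F2_def)
    moreover have "(P * (z \<bullet> z)) *\<^sub>R ((\<alpha> * F) *\<^sub>R h + (\<alpha> * (F1 * D h)) *\<^sub>R z + (F1 *\<^sub>R rot h + (F2 * D h) *\<^sub>R rot z))
         + ((\<alpha> - 2) * P * (z \<bullet> h)) *\<^sub>R ((\<alpha> * F) *\<^sub>R z + F1 *\<^sub>R rot z)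
       = polar_hessian \<alpha> (\<alpha> * (\<alpha> - 1) * F) ((\<alpha> - 1) * F1) (F2 + \<alpha> * F) z *v h" for h
    proof -
      \<comment> \<open>With the quotient replaced by a symbol \<open>E\<close> subject to this one
        relation, each component is a polynomial identity.\<close>
      have Dh: "(z \<bullet> z) * D h = h $ 1 * z $ 2 - h $ 2 * z $ 1" using pos by (simp add: D_def)
      define E where "E = D h"
      have 1: "(P * (z \<bullet> z)) * (\<alpha> * F * h $ 1 + \<alpha> * (F1 * E) * z $ 1 + (F1 * h $ 2 + F2 * E * z $ 2))
         + (\<alpha> - 2) * P * (z \<bullet> h) * (\<alpha> * F * z $ 1 + F1 * z $ 2)
       = P * ((\<alpha> * (\<alpha> - 1) * F * (z $ 1)\<^sup>2 + 2 * ((\<alpha> - 1) * F1) * (z $ 1 * z $ 2) + (F2 + \<alpha> * F) * (z $ 2)\<^sup>2) * h $ 1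
           + ((\<alpha> * (\<alpha> - 1) * F - (F2 + \<alpha> * F)) * (z $ 1 * z $ 2) + (\<alpha> - 1) * F1 * ((z $ 2)\<^sup>2 - (z $ 1)\<^sup>2)) * h $ 2)"
        using Dh unfolding inner_real2 E_def[symmetric] by algebra
      have 2: "(P * (z \<bullet> z)) * (\<alpha> * F * h $ 2 + \<alpha> * (F1 * E) * z $ 2 + (F1 * (- h $ 1) + F2 * E * (- z $ 1)))
         + (\<alpha> - 2) * P * (z \<bullet> h) * (\<alpha> * F * z $ 2 + F1 * (- z $ 1))
       = P * (((\<alpha> * (\<alpha> - 1) * F - (F2 + \<alpha> * F)) * (z $ 1 * z $ 2) + (\<alpha> - 1) * F1 * ((z $ 2)\<^sup>2 - (z $ 1)\<^sup>2)) * h $ 1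
          + (\<alpha> * (\<alpha> - 1) * F * (z $ 2)\<^sup>2 - 2 * ((\<alpha> - 1) * F1) * (z $ 1 * z $ 2) + (F2 + \<alpha> * F) * (z $ 1)\<^sup>2) * h $ 2)"
        using Dh unfolding inner_real2 E_def[symmetric] by algebra
      show ?thesis
        using 1 2 by (simp only: vec_eq_iff forall_2)
          (simp add: polar_hessian_def matrix_vector_mult_def sum_2 rot_def P_def[symmetric]
            E_def[symmetric] distrib_left mult.assoc)
    qed
    ultimately show ?thesis unfolding F_def F1_def F2_def by simp
  qed
  have 3: "continuous_on N (\<lambda>z. polar_hessian \<alpha> (\<alpha> * (\<alpha> - 1) * f (ang z)) ((\<alpha> - 1) * f1 (ang z)) (f2 (ang z) + \<alpha> * f (ang z)) z)"
  proof -
    have "continuous_on N ang"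
      by (intro continuous_at_imp_continuous_on ballI has_derivative_continuous[OF has_derivative_ang] N(2))
    then have f2: "continuous_on N (\<lambda>z. f2 (ang z))"
      by (rule continuous_on_compose2[OF f(3) _ I(2)])
    have f01: "continuous_on N (\<lambda>z. f (ang z))" "continuous_on N (\<lambda>z. f1 (ang z))"
      by (intro continuous_at_imp_continuous_on ballI has_derivative_continuous[OF f'(1)]
          has_derivative_continuous[OF f'(2)]; assumption)+
    show ?thesis unfolding polar_hessian_def
      using nz by (intro continuous_intros continuous_on_vector_2 f2 f01) auto
  qed
  show ?thesis
    unfolding C2_with_def gderiv_def by (intro conjI ballI N(1) 1 2 3)
qed

text \<open>Trace and determinant give the eigenvalues 2e - m and 2e + k m. The choice of
  \<open>k\<close> cancels the contribution of m to the weighted sum, leaving 2e(lam + Lam).\<close>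

lemma pucci_minus_polar_hessian:
  assumes z: "z \<noteq> 0" and tr: "a + d = n * (k - 1)" and det: "a * d - b\<^sup>2 = - k * n\<^sup>2"
    and n: "n \<ge> 0 \<and> k * lam = Lam \<or> n \<le> 0 \<and> k * Lam = lam" and k: "k > 0"
    and lam: "0 < lam" "lam \<le> Lam" and c: "c \<ge> 0" and e: "e > 0"
  shows "pucci_minus lam Lam (c *\<^sub>R polar_hessian \<alpha> a b d z + mat (2 * e)) > 0"
proof -
  define P where "P = (z \<bullet> z) powr (\<alpha> / 2 - 2)"
  define r where "r = z \<bullet> z"
  define m where "m = c * P * r * n"
  let ?M = "c *\<^sub>R polar_hessian \<alpha> a b d z + mat (2 * e)"
  have r: "r = (z $ 1)\<^sup>2 + (z $ 2)\<^sup>2" by (simp add: r_def inner_real2 power2_eq_square)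
  have "r > 0" using z by (simp add: r_def)
  have Pc: "c * P * r \<ge> 0" using \<open>r > 0\<close> c by (simp add: P_def)
  have 1: "?M $ 1 $ 1 + ?M $ 2 $ 2 = (2 * e - m) + (2 * e + k * m)"
  proof -
    have "?M $ 1 $ 1 + ?M $ 2 $ 2 = c * P * r * (a + d) + 4 * e"
      unfolding polar_hessian_def P_def[symmetric] r by (simp add: mat_def algebra_simps)
    then show ?thesis by (simp add: tr m_def algebra_simps)
  qed
  have 2: "?M $ 1 $ 1 * ?M $ 2 $ 2 - ?M $ 1 $ 2 * ?M $ 2 $ 1 = (2 * e - m) * (2 * e + k * m)"
  proof -
    have "?M $ 1 $ 1 * ?M $ 2 $ 2 - ?M $ 1 $ 2 * ?M $ 2 $ 1
        = (c * P * r)\<^sup>2 * (a * d - b\<^sup>2) + 2 * e * (c * P * r) * (a + d) + 4 * e\<^sup>2"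
      unfolding polar_hessian_def P_def[symmetric] r by (simp add: mat_def) algebra
    then show ?thesis unfolding tr det m_def by (simp add: algebra_simps power2_eq_square)
  qed
  have "(lam * max (2 * e - m) 0 + Lam * min (2 * e - m) 0) +
     (lam * max (2 * e + k * m) 0 + Lam * min (2 * e + k * m) 0) > 0"
  proof -
    \<comment> \<open>The shift by 2e may carry the eigenvalue p across 0; then both eigenvalues are
      positive and so is the operator.\<close>
    have key: "(lam * max p 0 + Lam * min p 0) + (lam * max q 0 + Lam * min q 0) > 0"
      if "q > 0" "lam * q + Lam * p > 0" for p q
    proof (cases "p \<le> 0")
      case False
      then show ?thesis using that(1) lam by (simp add: add_pos_pos)
    qed (use that in simp)
    have Lam: "Lam > 0" using lam by simp
    from n show ?thesis
    proof
      assume n: "n \<ge> 0 \<and> k * lam = Lam"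
      then have "m \<ge> 0" using Pc by (simp add: m_def)
      then have "lam * (2 * e + k * m) + Lam * (2 * e - m) = 2 * e * (lam + Lam)"
        using n by (auto simp: algebra_simps)
      moreover have "2 * e * (lam + Lam) > 0" using e lam Lam by simp
      moreover have "2 * e + k * m > 0" using \<open>m \<ge> 0\<close> e k by (simp add: add_pos_nonneg)
      ultimately show ?thesis using key[of "2 * e + k * m" "2 * e - m"] by simp
    next
      assume n: "n \<le> 0 \<and> k * Lam = lam"
      then have "m \<le> 0" using Pc by (simp add: m_def mult_nonneg_nonpos)
      then have "lam * (2 * e - m) + Lam * (2 * e + k * m) = 2 * e * (lam + Lam)"
        using n by (auto simp: algebra_simps)
      moreover have "2 * e * (lam + Lam) > 0" using e lam Lam by simp
      moreover have "2 * e - m > 0" using \<open>m \<le> 0\<close> e by simp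
      ultimately show ?thesis using key[of "2 * e - m" "2 * e + k * m"] by (simp add: add_ac)
    qed
  qed
  then show ?thesis unfolding pucci_minus_2x2[OF 1 2] .
qed

section \<open>The angular profile\<close>

text \<open>All branches of \<open>G_fun\<close> are one function: \<open>k\<close> is \<open>\<omega>\<close> or, for \<open>0 < \<alpha> < 1\<close>, \<open>1/\<omega>\<close> (which swaps
  the two coefficients), and \<open>s\<close> is the common sign of \<open>\<alpha>\<close> and of the coefficients.\<close>

locale profile =
  fixes k \<alpha> s :: real
  assumes k: "k > 0" and s: "s = 1 \<or> s = - 1" and s_\<alpha>: "s * \<alpha> > 0"
    and s_A: "s * (\<alpha> - 1 + 1 / k) > 0" and s_B: "s * (\<alpha> - 1 + k) > 0"
begin

definition A where "A = \<alpha> - 1 + 1 / k"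
definition B where "B = \<alpha> - 1 + k"

definition G :: "real \<Rightarrow> real" where
  "G x = s * arctan (sqrt k * x) + (2 - \<alpha>) / sqrt (A * B) * arctan (sqrt (k * A / B) * x)"

definition G' :: "real \<Rightarrow> real" where
  "G' x = s * sqrt k * (1 + k) * (1 + x\<^sup>2) / ((1 + k * x\<^sup>2) * (B + k * A * x\<^sup>2))"

lemma s_sq: "s * s = 1" using s by auto

lemma kA: "k * A = k * (\<alpha> - 1) + 1"
  using k by (simp add: A_def algebra_simps)

lemma A_B_pos: "A * B > 0" "A / B > 0" "k * A / B > 0" "B \<noteq> 0" "A \<noteq> 0"
proof -
  have sA: "s * A > 0" and sB: "s * B > 0" using s_A s_B by (simp_all add: A_def B_def)
  then have "(s * A) * (s * B) > 0" by (rule mult_pos_pos)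
  then show "A * B > 0" using s_sq by (metis mult.assoc mult.left_commute mult_1)
  then show "A / B > 0" "B \<noteq> 0" "A \<noteq> 0" by (auto simp: zero_less_divide_iff zero_less_mult_iff)
  then show "k * A / B > 0" using k by (metis mult_pos_pos times_divide_eq_right)
qed

lemma denom_pos: "1 + k * x\<^sup>2 > 0" "s * (B + k * A * x\<^sup>2) > 0" "1 + k * A / B * x\<^sup>2 > 0"
proof -
  show "1 + k * x\<^sup>2 > 0" using k by (simp add: add_pos_nonneg)
  show "1 + k * A / B * x\<^sup>2 > 0" using A_B_pos(3) by (metis add_pos_nonneg less_eq_real_def mult_nonneg_nonneg zero_le_power2 zero_less_one)
  have "s * A \<ge> 0" "s * B > 0" using s_A s_B by (simp_all add: A_def B_def)
  then have "s * B + k * (s * A) * x\<^sup>2 > 0" using k by (simp add: add_pos_nonneg)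
  then show "s * (B + k * A * x\<^sup>2) > 0" by (simp add: algebra_simps)
qed

lemma denom_nz: "1 + k * x\<^sup>2 \<noteq> 0" "B + k * A * x\<^sup>2 \<noteq> 0" "1 + k * A / B * x\<^sup>2 \<noteq> 0"
  using denom_pos[of x] by auto

lemma G'_pos: "G' x > 0"
proof -
  define d where "d = B + k * A * x\<^sup>2"
  have "G' x = (sqrt k * (1 + k) * (1 + x\<^sup>2)) / ((1 + k * x\<^sup>2) * (s * d))"
    using s by (auto simp: G'_def d_def[symmetric])
  moreover have "sqrt k * (1 + k) * (1 + x\<^sup>2) > 0" using k by (simp add: add_pos_nonneg)
  ultimately show ?thesis using denom_pos[of x] by (simp add: d_def)
qed

text \<open>The quotient is sqrt k / |B|, and |B| = s B. Thus both arctangents contribute the same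
  sign s to the derivative of \<open>G\<close>.\<close>

lemma sqrt_A_B: "sqrt (k * A / B) / sqrt (A * B) = s * sqrt k / B"
proof -
  have "s * B > 0" using s_B by (simp add: B_def)
  then have "sqrt (B * B) = s * B" using s by auto
  then have "sqrt (A * B) = sqrt (A / B) * (s * B)"
    using real_sqrt_mult[of "A / B" "B * B"] A_B_pos(4) by (simp add: mult.assoc)
  moreover have "sqrt (k * A / B) = sqrt k * sqrt (A / B)"
    by (simp add: real_sqrt_mult[symmetric])
  ultimately show ?thesis using A_B_pos(2,4) s by (auto simp: field_simps)
qed

lemma DERIV_G: "(G has_real_derivative G' x) (at x)"
proof -
  have "(G has_real_derivative s * (sqrt k / (1 + k * x\<^sup>2))
     + (2 - \<alpha>) * (sqrt (k * A / B) / sqrt (A * B)) / (1 + k * A / B * x\<^sup>2)) (at x)"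
    unfolding G_def[abs_def]
    using k A_B_pos by (auto intro!: derivative_eq_intros simp: power_mult_distrib divide_inverse)
  moreover have "s * (sqrt k / (1 + k * x\<^sup>2)) + (2 - \<alpha>) * (sqrt (k * A / B) / sqrt (A * B)) / (1 + k * A / B * x\<^sup>2)
     = G' x"
  proof -
    have "1 + k * A / B * x\<^sup>2 = (B + k * A * x\<^sup>2) / B"
      using A_B_pos(4) by (simp add: field_simps)
    then have "(2 - \<alpha>) * (s * sqrt k / B) / (1 + k * A / B * x\<^sup>2) = s * sqrt k * (2 - \<alpha>) / (B + k * A * x\<^sup>2)"
      using A_B_pos(4) by simp
    moreover have "s * (sqrt k / (1 + k * x\<^sup>2)) + s * sqrt k * (2 - \<alpha>) / (B + k * A * x\<^sup>2)
       = s * sqrt k * ((B + k * A * x\<^sup>2) + (2 - \<alpha>) * (1 + k * x\<^sup>2)) / ((1 + k * x\<^sup>2) * (B + k * A * x\<^sup>2))"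
      using denom_nz[of x] by (simp add: field_simps)
    \<comment> \<open>Here \<alpha> drops out of the numerator. The derivative therefore factors
      with a visible sign, and depends on \<alpha> only through its denominator.\<close>
    moreover have "(B + k * A * x\<^sup>2) + (2 - \<alpha>) * (1 + k * x\<^sup>2) = (1 + k) * (1 + x\<^sup>2)"
      unfolding kA B_def by algebra
    ultimately show ?thesis unfolding sqrt_A_B G'_def by simp
  qed
  ultimately show ?thesis by simp
qed

lemma G_less: "x < y \<Longrightarrow> G x < G y"
  by (rule DERIV_pos_imp_increasing) (use DERIV_G G'_pos in blast)+

lemma strict_mono_G: "strict_mono G"
  using G_less by (rule strict_monoI)

lemma inj_G: "inj G"
  using strict_mono_G by (rule strict_mono_imp_inj_on)

lemma G_0: "G 0 = 0" and G_minus: "G (- x) = - G x"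
  by (simp_all add: G_def arctan_minus)

lemma isCont_G: "isCont G x"
  using DERIV_G by (rule DERIV_isCont)

definition Xi :: "real \<Rightarrow> real" where "Xi = inv G"

lemma Xi_G [simp]: "Xi (G x) = x"
  unfolding Xi_def using inj_G by (rule inv_f_f)

text \<open>\<open>G\<close> is odd, so on a neighbourhood of \<open>[- G 1, G 1]\<close> its inverse extends the one of the
  statement to negative angles. Only the endpoints beyond \<open>\<plusminus> 1\<close> matter, not the value 2.\<close>

definition I :: "real set" where "I = {G (- 2)<..<G 2}"

lemma I_eq: assumes "t \<in> I" obtains x where "t = G x"
proof -
  have "\<exists>x\<ge>-2. x \<le> 2 \<and> G x = t"
    using assms by (intro IVT) (auto simp: I_def isCont_G)
  then show thesis using that by auto
qed

lemma DERIV_Xi: assumes "t \<in> I" shows "(Xi has_real_derivative inverse (G' (Xi t))) (at t)"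
proof (rule DERIV_inverse_function[where f = G and a = "G (- 2)" and b = "G 2"])
  obtain x where x: "t = G x" using assms I_eq by blast
  show "(G has_real_derivative G' (Xi t)) (at (Xi t))" by (rule DERIV_G)
  show "G' (Xi t) \<noteq> 0" using G'_pos[of "Xi t"] by simp
  show "G (- 2) < t" "t < G 2" using assms by (auto simp: I_def)
  show "G (Xi y) = y" if "G (- 2) < y" "y < G 2" for y
    by (rule I_eq[of y]) (use that in \<open>simp_all add: I_def\<close>)
  show "isCont Xi t"
    unfolding x by (rule isCont_inverse_function[where d = 1 and f = G and x = x])
      (simp_all only: Xi_G isCont_G zero_less_one)
qed

text \<open>The profile without its factor 1 - X^2. It is positive on the whole line, so that factor
  alone decides the sign and the zeros of the profile.\<close>

definition Q :: "real \<Rightarrow> real" where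
  "Q x = (1 + k * A / B * x\<^sup>2) powr ((\<alpha> - 2) / 2) * (1 + k * x\<^sup>2) powr (- (\<alpha> / 2))"

lemma Q_pos: "Q x > 0"
  using denom_nz[of x] by (simp add: Q_def)

text \<open>Written through the logarithmic derivative, so that \<open>Q\<close> factors out of the
  later identities and rational ones remain.\<close>

lemma DERIV_Q:
  "(Q has_real_derivative Q x * ((\<alpha> - 2) * k * A * x / (B + k * A * x\<^sup>2) - \<alpha> * k * x / (1 + k * x\<^sup>2))) (at x)"
proof -
  define l where "l = k * A / B"
  have l: "1 + l * x\<^sup>2 > 0" using denom_pos(3) by (simp add: l_def)
  have "((\<lambda>x. (1 + l * x\<^sup>2) powr ((\<alpha> - 2) / 2) * (1 + k * x\<^sup>2) powr (- (\<alpha> / 2))) has_real_derivative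
     ((\<alpha> - 2) / 2 * (1 + l * x\<^sup>2) powr ((\<alpha> - 2) / 2 - 1) * (l * (2 * x))) * (1 + k * x\<^sup>2) powr (- (\<alpha> / 2))
     + (- (\<alpha> / 2) * (1 + k * x\<^sup>2) powr (- (\<alpha> / 2) - 1) * (k * (2 * x))) * (1 + l * x\<^sup>2) powr ((\<alpha> - 2) / 2)) (at x)"
  proof (rule DERIV_mult)
    have d: "((\<lambda>x. 1 + c * x\<^sup>2) has_real_derivative c * (2 * x)) (at x)" for c :: real
      by (auto intro!: derivative_eq_intros)
    show "((\<lambda>x. (1 + l * x\<^sup>2) powr ((\<alpha> - 2) / 2)) has_real_derivative
      (\<alpha> - 2) / 2 * (1 + l * x\<^sup>2) powr ((\<alpha> - 2) / 2 - 1) * (l * (2 * x))) (at x)"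
      by (rule DERIV_chain2[OF has_real_derivative_powr[OF l] d])
    show "((\<lambda>x. (1 + k * x\<^sup>2) powr (- (\<alpha> / 2))) has_real_derivative
      - (\<alpha> / 2) * (1 + k * x\<^sup>2) powr (- (\<alpha> / 2) - 1) * (k * (2 * x))) (at x)"
      by (rule DERIV_chain2[OF has_real_derivative_powr[OF denom_pos(1)] d])
  qed
  moreover have "((\<alpha> - 2) / 2 * (1 + l * x\<^sup>2) powr ((\<alpha> - 2) / 2 - 1) * (l * (2 * x))) * (1 + k * x\<^sup>2) powr (- (\<alpha> / 2))
     + (- (\<alpha> / 2) * (1 + k * x\<^sup>2) powr (- (\<alpha> / 2) - 1) * (k * (2 * x))) * (1 + l * x\<^sup>2) powr ((\<alpha> - 2) / 2)
    = Q x * ((\<alpha> - 2) * (l * x / (1 + l * x\<^sup>2)) - \<alpha> * k * x / (1 + k * x\<^sup>2))"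
  proof -
    have "((\<alpha> - 2) / 2 * (U / a) * (l * (2 * x))) * V + (- (\<alpha> / 2) * (V / b) * (k * (2 * x))) * U
      = U * V * ((\<alpha> - 2) * (l * x / a) - \<alpha> * k * x / b)" if "a \<noteq> 0" "b \<noteq> 0" for a b U V :: real
      using that by (simp add: field_simps)
    from this[of "1 + l * x\<^sup>2" "1 + k * x\<^sup>2"] show ?thesis
      unfolding powr_diff Q_def l_def[symmetric] using l denom_pos(1)[of x] by simp
  qed
  moreover have "l * x / (1 + l * x\<^sup>2) = k * A * x / (B + k * A * x\<^sup>2)"
  proof -
    have "1 + l * x\<^sup>2 = (B + k * A * x\<^sup>2) / B" using A_B_pos(4) by (simp add: l_def field_simps)
    then show ?thesis using A_B_pos(4) by (simp add: l_def)
  qed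
  ultimately show ?thesis unfolding Q_def[abs_def] l_def[symmetric] by (simp add: mult.assoc)
qed

text \<open>\<open>F1\<close> and \<open>F2\<close> are the first and second derivatives of the profile with respect to the angle,
  written in the parameter \<open>x = Xi \<theta>\<close>.\<close>

definition F0 where "F0 x = (1 - x\<^sup>2) * Q x"
definition F1 where "F1 x = - s * \<alpha> * (1 + k) / sqrt k * x * Q x"
definition F2 where "F2 x = - (\<alpha> / k) * Q x * (B - k\<^sup>2 * A * x\<^sup>2)"

text \<open>The numerator collapses to a multiple of 1 + x^2, which is also a factor of
  \<open>G'\<close>. Division by \<open>G'\<close> cancels it together with both denominators,
  whence the simple form of \<open>F1\<close>.\<close>

lemma DERIV_F0: "(F0 has_real_derivative F1 x * G' x) (at x)"
proof -
  define D1 where "D1 = 1 + k * x\<^sup>2"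
  define D2 where "D2 = B + k * A * x\<^sup>2"
  have nz: "D1 \<noteq> 0" "D2 \<noteq> 0" using denom_nz[of x] by (auto simp: D1_def D2_def)
  have "(F0 has_real_derivative - (2 * x) * Q x
      + Q x * ((\<alpha> - 2) * k * A * x / D2 - \<alpha> * k * x / D1) * (1 - x\<^sup>2)) (at x)"
    unfolding F0_def[abs_def] D1_def D2_def
    by (rule derivative_eq_intros DERIV_Q refl)+ simp
  moreover have "- (2 * x) * Q x + Q x * ((\<alpha> - 2) * k * A * x / D2 - \<alpha> * k * x / D1) * (1 - x\<^sup>2)
     = Q x * x * (- 2 * D1 * D2 + (1 - x\<^sup>2) * ((\<alpha> - 2) * (k * A) * D1 - \<alpha> * k * D2)) / (D1 * D2)"
    using nz by (simp add: field_simps)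
  moreover have "- 2 * D1 * D2 + (1 - x\<^sup>2) * ((\<alpha> - 2) * (k * A) * D1 - \<alpha> * k * D2) = - \<alpha> * (1 + k)\<^sup>2 * (1 + x\<^sup>2)"
    unfolding D1_def D2_def kA B_def by algebra
  moreover have "F1 x * G' x = Q x * x * (- \<alpha> * (1 + k)\<^sup>2 * (1 + x\<^sup>2)) / (D1 * D2)"
    unfolding F1_def G'_def D1_def[symmetric] D2_def[symmetric] using k s
    by (auto simp: power2_eq_square)
  ultimately show ?thesis by simp
qed

lemma DERIV_F1: "(F1 has_real_derivative F2 x * G' x) (at x)"
proof -
  define D1 where "D1 = 1 + k * x\<^sup>2"
  define D2 where "D2 = B + k * A * x\<^sup>2"
  define c where "c = - s * \<alpha> * (1 + k) / sqrt k"
  have nz: "D1 \<noteq> 0" "D2 \<noteq> 0" using denom_nz[of x] by (auto simp: D1_def D2_def)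
  have "((\<lambda>x. c * x * Q x) has_real_derivative c * Q x
      + Q x * ((\<alpha> - 2) * k * A * x / D2 - \<alpha> * k * x / D1) * (c * x)) (at x)"
    unfolding D1_def D2_def
    by (rule derivative_eq_intros DERIV_Q refl)+ simp
  moreover have "c * Q x + Q x * ((\<alpha> - 2) * k * A * x / D2 - \<alpha> * k * x / D1) * (c * x)
     = c * Q x * (D1 * D2 + x\<^sup>2 * ((\<alpha> - 2) * (k * A) * D1 - \<alpha> * k * D2)) / (D1 * D2)"
    using nz by (simp add: field_simps power2_eq_square)
  \<comment> \<open>Again 1 + x^2 splits off and cancels against \<open>G'\<close>.\<close>
  moreover have "D1 * D2 + x\<^sup>2 * ((\<alpha> - 2) * (k * A) * D1 - \<alpha> * k * D2) = (1 + x\<^sup>2) * (B - k * (k * A) * x\<^sup>2)"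
    unfolding D1_def D2_def kA B_def by algebra
  moreover have "c * Q x * ((1 + x\<^sup>2) * (B - k * (k * A) * x\<^sup>2)) / (D1 * D2) = F2 x * G' x"
  proof -
    have "c = - (\<alpha> / k) * (s * sqrt k * (1 + k))"
      using k by (simp add: c_def field_simps)
    then show ?thesis unfolding F2_def G'_def D1_def[symmetric] D2_def[symmetric]
      by (simp add: power2_eq_square mult_ac)
  qed
  ultimately show ?thesis unfolding F1_def[abs_def] c_def[symmetric] by simp
qed

definition f where "f t = F0 (Xi t)"
definition f1 where "f1 t = F1 (Xi t)"
definition f2 where "f2 t = F2 (Xi t)"

lemma DERIV_f: assumes "t \<in> I" shows "(f has_real_derivative f1 t) (at t)"
  using DERIV_chain2[OF DERIV_F0 DERIV_Xi[OF assms]] G'_pos[of "Xi t"]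
  by (simp add: f_def[abs_def] f1_def mult.assoc)

lemma DERIV_f1: assumes "t \<in> I" shows "(f1 has_real_derivative f2 t) (at t)"
  using DERIV_chain2[OF DERIV_F1 DERIV_Xi[OF assms]] G'_pos[of "Xi t"]
  by (simp add: f1_def[abs_def] f2_def mult.assoc)

lemma continuous_on_f2: "continuous_on I f2"
proof -
  have "continuous_on I Xi"
    by (intro continuous_at_imp_continuous_on ballI DERIV_isCont[OF DERIV_Xi])
  moreover have "continuous_on UNIV F2"
    unfolding F2_def[abs_def]
    by (intro continuous_intros continuous_at_imp_continuous_on ballI DERIV_isCont[OF DERIV_Q])
  ultimately show ?thesis
    unfolding f2_def[abs_def] by (intro continuous_on_compose2[of UNIV F2 I Xi]) auto
qed

text \<open>The Hessian of \<open>\<rho> powr \<alpha> * f \<theta>\<close> has the eigenvalues \<open>- n\<close> and \<open>k * n\<close>, up to the factor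
  \<open>\<rho> powr (\<alpha> - 2)\<close>.\<close>

definition n where "n t = \<alpha> * (\<alpha> - 1) * Q (Xi t) * (1 + k * (Xi t)\<^sup>2) / k"

text \<open>Multiplication by \<open>k\<close>, and squaring \<open>f1\<close> to remove sqrt k and
  s, makes everything polynomial in \<alpha>, \<open>k\<close>, \<open>Xi t\<close> and
  \<open>Q (Xi t)\<close>, as the trace and determinant identities require.\<close>

lemma
  shows k_f2: "k * f2 t = - \<alpha> * Q (Xi t) * (\<alpha> - 1 + k - k * (k * (\<alpha> - 1) + 1) * (Xi t)\<^sup>2)"
    and k_n: "k * n t = \<alpha> * (\<alpha> - 1) * Q (Xi t) * (1 + k * (Xi t)\<^sup>2)"
    and k_f1: "k * (f1 t)\<^sup>2 = \<alpha>\<^sup>2 * (1 + k)\<^sup>2 * (Xi t)\<^sup>2 * (Q (Xi t))\<^sup>2"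
proof -
  have "k * f2 t = - \<alpha> * Q (Xi t) * (B - k * (k * A) * (Xi t)\<^sup>2)"
    using k by (simp add: f2_def F2_def power2_eq_square mult.assoc)
  then show "k * f2 t = - \<alpha> * Q (Xi t) * (\<alpha> - 1 + k - k * (k * (\<alpha> - 1) + 1) * (Xi t)\<^sup>2)"
    by (simp only: kA B_def)
  show "k * n t = \<alpha> * (\<alpha> - 1) * Q (Xi t) * (1 + k * (Xi t)\<^sup>2)"
    using k by (simp add: n_def)
  show "k * (f1 t)\<^sup>2 = \<alpha>\<^sup>2 * (1 + k)\<^sup>2 * (Xi t)\<^sup>2 * (Q (Xi t))\<^sup>2"
    using k s by (auto simp: f1_def F1_def power_mult_distrib power_divide)
qed

lemma f_trace: "\<alpha> * (\<alpha> - 1) * f t + (f2 t + \<alpha> * f t) = n t * (k - 1)"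
proof -
  have "f t = (1 - (Xi t)\<^sup>2) * Q (Xi t)" by (simp add: f_def F0_def)
  then have "k * (\<alpha> * (\<alpha> - 1) * f t + (f2 t + \<alpha> * f t)) = k * (n t * (k - 1))"
    using k_f2[of t] k_n[of t] by algebra
  then show ?thesis using k by simp
qed

lemma f_det: "\<alpha> * (\<alpha> - 1) * f t * (f2 t + \<alpha> * f t) - ((\<alpha> - 1) * f1 t)\<^sup>2 = - k * (n t)\<^sup>2"
proof -
  have "f t = (1 - (Xi t)\<^sup>2) * Q (Xi t)" by (simp add: f_def F0_def)
  then have "k * (k * (\<alpha> * (\<alpha> - 1) * f t * (f2 t + \<alpha> * f t) - ((\<alpha> - 1) * f1 t)\<^sup>2)) = k * (k * (- k * (n t)\<^sup>2))"
    using k_f2[of t] k_n[of t] k_f1[of t] by algebra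
  then show ?thesis using k by (simp only: mult_cancel_left) simp
qed

text \<open>The remaining factors of \<open>n\<close> are positive, so its sign is the same at all
  angles and one value of \<open>k\<close> serves the whole cone.\<close>

lemma n_sign: "\<alpha> * (\<alpha> - 1) \<ge> 0 \<Longrightarrow> n t \<ge> 0" "\<alpha> * (\<alpha> - 1) \<le> 0 \<Longrightarrow> n t \<le> 0"
proof -
  have "n t = \<alpha> * (\<alpha> - 1) * (Q (Xi t) * (1 + k * (Xi t)\<^sup>2) / k)" by (simp add: n_def)
  moreover have "Q (Xi t) * (1 + k * (Xi t)\<^sup>2) / k \<ge> 0"
    using Q_pos[of "Xi t"] denom_pos(1)[of "Xi t"] k by simp
  ultimately show "\<alpha> * (\<alpha> - 1) \<ge> 0 \<Longrightarrow> n t \<ge> 0" "\<alpha> * (\<alpha> - 1) \<le> 0 \<Longrightarrow> n t \<le> 0"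
    by (simp_all only: mult_nonneg_nonneg mult_nonpos_nonneg)
qed

end

section \<open>Barriers in the cone\<close>

lemma cos_ang: "z \<noteq> 0 \<Longrightarrow> norm z * cos (ang z) = z $ 2"
proof -
  assume "z \<noteq> 0"
  then have nz: "cplane z \<noteq> 0" by (metis norm_cplane norm_eq_zero)
  have "Re (exp (Ln (cplane z))) = exp (Re (Ln (cplane z))) * cos (Im (Ln (cplane z)))"
    by (rule Re_exp)
  moreover have "exp (Re (Ln (cplane z))) = norm z" using nz \<open>z \<noteq> 0\<close> by (simp add: norm_cplane)
  moreover have "Re (exp (Ln (cplane z))) = z $ 2" using nz by simp (simp add: cplane_def)
  ultimately show ?thesis by (simp add: ang_def)
qed

lemma abs_ang_le_pi: "z \<noteq> 0 \<Longrightarrow> \<bar>ang z\<bar> \<le> pi"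
proof -
  assume "z \<noteq> 0"
  then have nz: "cplane z \<noteq> 0" by (metis norm_cplane norm_eq_zero)
  then show ?thesis using mpi_less_Im_Ln[OF nz] Im_Ln_le_pi[OF nz] by (simp add: ang_def)
qed

lemma norm_real2: "norm (z :: real^2) = sqrt ((z $ 1)\<^sup>2 + (z $ 2)\<^sup>2)"
  by (simp add: norm_vec_def L2_set_def sum_2)

lemma polar_angle_eq_abs_ang: "z \<noteq> 0 \<Longrightarrow> polar_angle z = \<bar>ang z\<bar>"
proof -
  assume z: "z \<noteq> 0"
  have "z $ 2 / norm z = cos \<bar>ang z\<bar>"
    using cos_ang[OF z] z by (simp add: field_simps)
  then show ?thesis
    unfolding polar_angle_def norm_real2[symmetric]
    using arccos_cos[of "\<bar>ang z\<bar>"] abs_ang_le_pi[OF z] by simp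
qed

lemma mem_cone_C0:
  assumes "0 < \<theta>0" "\<theta>0 < pi"
  shows "z \<in> cone_C0 \<theta>0 \<longleftrightarrow> z \<noteq> 0 \<and> \<bar>ang z\<bar> < \<theta>0"
proof (cases "z = 0")
  case False
  have "z \<in> cone_C0 \<theta>0 \<longleftrightarrow> cos \<theta>0 * norm z < norm z * cos \<bar>ang z\<bar>"
    using cos_ang[OF False] by (simp add: cone_C0_def norm_real2)
  also have "\<dots> \<longleftrightarrow> cos \<theta>0 < cos \<bar>ang z\<bar>" using False by (simp add: mult.commute)
  also have "\<dots> \<longleftrightarrow> \<bar>ang z\<bar> < \<theta>0"
    using assms abs_ang_le_pi[OF False] by (intro cos_mono_less_eq) auto
  finally show ?thesis using False by simp
qed (simp add: cone_C0_def)

lemma abs_ang_le_of_closure_cone_C0: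
  assumes "0 < \<theta>0" "\<theta>0 < pi" "z \<in> closure (cone_C0 \<theta>0)" "z \<noteq> 0"
  shows "\<bar>ang z\<bar> \<le> \<theta>0"
proof -
  have "closed {z :: real^2. cos \<theta>0 * norm z \<le> z $ 2}"
    by (intro closed_Collect_le continuous_intros)
  moreover have "cone_C0 \<theta>0 \<subseteq> {z. cos \<theta>0 * norm z \<le> z $ 2}"
    by (auto simp: cone_C0_def norm_real2)
  ultimately have "closure (cone_C0 \<theta>0) \<subseteq> {z. cos \<theta>0 * norm z \<le> z $ 2}"
    by (intro closure_minimal)
  with assms(3) have "cos \<theta>0 * norm z \<le> norm z * cos \<bar>ang z\<bar>"
    by (simp add: cos_ang[OF assms(4)] subset_iff)
  then have "cos \<theta>0 \<le> cos \<bar>ang z\<bar>" using assms(4) by (simp add: mult.commute)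
  then show ?thesis
    using assms abs_ang_le_pi[OF assms(4)] by (subst (asm) cos_mono_le_eq) auto
qed

lemma cplane_not_nonpos_Reals:
  assumes "z \<noteq> 0" "\<bar>ang z\<bar> < pi"
  shows "cplane z \<notin> \<real>\<^sub>\<le>\<^sub>0"
proof
  assume *: "cplane z \<in> \<real>\<^sub>\<le>\<^sub>0"
  have nz: "cplane z \<noteq> 0" using assms(1) by (metis norm_cplane norm_eq_zero)
  then have "Re (cplane z) \<noteq> 0" using * by (auto simp: complex_nonpos_Reals_iff complex_eq_iff)
  then have "Im (Ln (cplane z)) = pi"
    using * nz by (subst Im_Ln_eq_pi) (auto simp: complex_nonpos_Reals_iff)
  then show False using assms(2) by (simp add: ang_def)
qed

lemma open_cone_C0: "open (cone_C0 \<theta>0)"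
  unfolding cone_C0_def by (intro open_Collect_less continuous_intros)

lemma inner_self_powr_half: "(z \<bullet> z) powr (p / 2) = norm z powr p"
proof (cases "z = 0")
  case False
  then show ?thesis
    using powr_powr[of "norm z" 2 "p / 2"] by (simp add: dot_square_norm)
qed simp

lemma lsc_on_subset:
  assumes "lsc_on S u" "T \<subseteq> S"
  shows "lsc_on T u"
  unfolding lsc_on_def le_Liminf_iff
proof (intro ballI allI impI)
  fix x y assume "x \<in> T" "y < u x"
  then have "eventually (\<lambda>z. y < u z) (at x within S)"
    using assms unfolding lsc_on_def le_Liminf_iff by blast
  then show "eventually (\<lambda>z. y < u z) (at x within T)"
    by (rule filter_leD[OF at_le[OF assms(2)]])
qed

section \<open>Parity, sign and boundary values of the profile\<close>

context profile
begin

lemma abs_le_G1: "\<bar>t\<bar> \<le> G 1 \<Longrightarrow> t \<in> I"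
  using G_less[of 1 2] by (simp add: I_def G_minus abs_le_iff)

lemma G_Xi: "t \<in> I \<Longrightarrow> G (Xi t) = t"
  using I_eq[of t] Xi_G by metis

lemma Xi_minus: "t \<in> I \<Longrightarrow> Xi (- t) = - Xi t"
  using I_eq[of t] Xi_G G_minus by metis

lemma f_minus: "t \<in> I \<Longrightarrow> f (- t) = f t"
  by (simp add: f_def F0_def Q_def Xi_minus)

lemma f_abs: "t \<in> I \<Longrightarrow> f \<bar>t\<bar> = f t"
  by (simp add: abs_if f_minus)

lemma Xi_less_1: assumes "\<bar>t\<bar> < G 1" shows "\<bar>Xi t\<bar> < 1"
proof -
  have t: "t \<in> I" using assms abs_le_G1 by simp
  have "G (Xi t) < G 1" "G (- 1) < G (Xi t)" using assms by (auto simp: G_Xi[OF t] G_minus)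
  then show ?thesis using strict_mono_less[OF strict_mono_G] by (simp add: abs_less_iff)
qed

lemma f_pos: assumes "\<bar>t\<bar> < G 1" shows "f t > 0"
  using Xi_less_1[OF assms] Q_pos by (simp add: f_def F0_def abs_square_less_1)

lemma f_boundary: assumes "\<bar>t\<bar> = G 1" shows "f t = 0"
proof -
  have "t \<in> I" using assms abs_le_G1 by simp
  then have "f t = f (G 1)" using f_abs assms by metis
  then show ?thesis by (simp add: f_def F0_def)
qed

lemma f_bounded: obtains M where "M > 0" "\<And>t. \<bar>t\<bar> \<le> G 1 \<Longrightarrow> \<bar>f t\<bar> \<le> M"
proof -
  have "continuous_on {- G 1..G 1} f"
    using abs_le_G1 by (intro continuous_at_imp_continuous_on ballI DERIV_isCont[OF DERIV_f]) auto
  then have "compact (f ` {- G 1..G 1})" by (rule compact_continuous_image) simp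
  then obtain M where "M > 0" "\<forall>x\<in>f ` {- G 1..G 1}. norm x \<le> M"
    using compact_imp_bounded bounded_pos by metis
  then show thesis using that by (auto simp: abs_le_iff)
qed

lemma G1_pos: "G 1 > 0"
  using G_less[of 0 1] G_0 by simp

end

text \<open>The opening is \<open>G 1\<close>, the first positive zero of the profile, so that the
  barrier vanishes on the sides of the cone. \<open>ellipticity\<close> pairs the sign of
  \<open>n\<close> with the matching value of \<open>k\<close>.\<close>

locale cone_supersolution = profile +
  fixes lam Lam :: real and u :: "real^2 \<Rightarrow> ereal"
  assumes G1: "G 1 < pi" and lam: "0 < lam" "lam \<le> Lam"
    and ellipticity: "\<alpha> * (\<alpha> - 1) \<ge> 0 \<and> k * lam = Lam \<or> \<alpha> * (\<alpha> - 1) \<le> 0 \<and> k * Lam = lam"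
    and u_nonneg: "\<And>z. z \<in> closure (cone_C0 (G 1)) \<Longrightarrow> 0 \<le> u z"
    and u_lsc: "lsc_on (closure (cone_C0 (G 1))) u"
    and u_super: "viscosity_supersolution (pucci_minus lam Lam) (cone_C0 (G 1)) u"
begin

abbreviation C where "C \<equiv> cone_C0 (G 1)"

definition V where "V z = (z \<bullet> z) powr (\<alpha> / 2) * f (ang z)"

lemma in_C: "z \<in> C \<longleftrightarrow> z \<noteq> 0 \<and> \<bar>ang z\<bar> < G 1"
  by (rule mem_cone_C0[OF G1_pos G1])

lemma ang_closure_C: "z \<in> closure C \<Longrightarrow> z \<noteq> 0 \<Longrightarrow> \<bar>ang z\<bar> \<le> G 1"
  by (rule abs_ang_le_of_closure_cone_C0[OF G1_pos G1])

text \<open>As \<open>0 powr p = 0\<close> for every p, this is the limit at the apex if \<alpha> >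
  0, but only a default value if \<alpha> < 0, where V is unbounded near the apex.\<close>

lemma V_0: "V 0 = 0"
  by (simp add: V_def)

lemma V_boundary: "z \<in> closure C \<Longrightarrow> z \<notin> C \<Longrightarrow> V z = 0"
  using V_0 ang_closure_C[of z] in_C[of z] f_boundary[of "ang z"] by (cases "z = 0") (auto simp: V_def)

lemma V_bounded:
  obtains M where "M > 0" "\<And>z. z \<in> closure C \<Longrightarrow> \<bar>V z\<bar> \<le> M * norm z powr \<alpha>"
proof -
  obtain M where M: "M > 0" "\<And>t. \<bar>t\<bar> \<le> G 1 \<Longrightarrow> \<bar>f t\<bar> \<le> M" using f_bounded by blast
  have "\<bar>V z\<bar> \<le> M * norm z powr \<alpha>" if "z \<in> closure C" for z
  proof (cases "z = 0")
    case False
    then show ?thesis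
      using M(2)[OF ang_closure_C[OF that False]]
      by (simp add: V_def inner_self_powr_half abs_mult mult.commute[of M] mult_left_mono)
  qed (simp add: V_0)
  then show thesis using that M(1) by blast
qed

lemma isCont_V: assumes "z \<in> closure C" "z \<noteq> 0" shows "isCont V z"
proof -
  have a: "\<bar>ang z\<bar> \<le> G 1" using ang_closure_C assms by blast
  have "isCont ang z"
    using cplane_not_nonpos_Reals[OF assms(2)] a G1
    by (intro has_derivative_continuous[OF has_derivative_ang]) simp
  moreover have "isCont f (ang z)" using a by (intro DERIV_isCont[OF DERIV_f] abs_le_G1)
  ultimately have "isCont (\<lambda>z. f (ang z)) z" by (rule isCont_o2)
  then show ?thesis
    unfolding V_def[abs_def] using assms(2) by (intro continuous_intros) auto
qed

lemma continuous_on_V: assumes "K \<subseteq> closure C" "\<alpha> > 0 \<or> 0 \<notin> K" shows "continuous_on K V"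
  unfolding continuous_on_eq_continuous_within
proof
  fix z assume z: "z \<in> K"
  show "continuous (at z within K) V"
  proof (cases "z = 0")
    case False
    have "z \<in> closure C" using z assms(1) by (rule rev_subsetD)
    then show ?thesis using False by (rule continuous_at_imp_continuous_at_within[OF isCont_V])
  next
    case True
    then have \<alpha>: "\<alpha> > 0" using assms(2) z by auto
    obtain M where M: "M > 0" "\<And>z. z \<in> closure C \<Longrightarrow> \<bar>V z\<bar> \<le> M * norm z powr \<alpha>"
      using V_bounded by blast
    have "((\<lambda>x. norm x powr \<alpha>) \<longlongrightarrow> 0) (at 0 within K)"
      using \<alpha> by (intro tendsto_zero_powrI[where b = \<alpha>] tendsto_norm_zero tendsto_const tendsto_ident_at) auto
    then have "((\<lambda>x. M * norm x powr \<alpha>) \<longlongrightarrow> 0) (at 0 within K)"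
      by (rule tendsto_mult_right_zero)
    then have "(V \<longlongrightarrow> 0) (at 0 within K)"
      by (rule Lim_null_comparison[rotated]) (use M(2) assms(1) in \<open>auto simp: eventually_at_filter intro!: always_eventually\<close>)
    then show ?thesis using True V_0 by (simp add: continuous_within)
  qed
qed

text \<open>For \<alpha> > 0 the choice r = 0 is allowed, and the apex then counts as boundary; for
  \<alpha> < 0 a positive r keeps the region away from the singularity. The constant
  \<open>d\<close> is left free to push the barrier below u on the boundary.\<close>

lemma annulus_comparison:
  fixes c e d r R :: real
  defines "\<psi> \<equiv> \<lambda>z. c * V z + e * (z \<bullet> z) + d"
  assumes r: "0 \<le> r" "\<alpha> > 0 \<or> r > 0" and c: "c \<ge> 0" and e: "e > 0"
    and bdry: "\<And>z. z \<in> closure C \<Longrightarrow> r \<le> norm z \<Longrightarrow> norm z \<le> R \<Longrightarrow>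
       norm z = r \<or> norm z = R \<or> z \<notin> C \<Longrightarrow> ereal (\<psi> z) \<le> u z"
    and z: "z \<in> C" "r < norm z" "norm z < R"
  shows "ereal (\<psi> z) \<le> u z"
proof -
  define U where "U = C \<inter> {z. r < norm z \<and> norm z < R}"
  have Uo: "open U"
    unfolding U_def by (intro open_Int open_cone_C0 open_Collect_conj open_Collect_less continuous_intros)
  have UC: "U \<subseteq> C" by (auto simp: U_def)
  have clC: "closure U \<subseteq> closure C" using UC by (rule closure_mono)
  have "closed {z :: real^2. r \<le> norm z \<and> norm z \<le> R}"
    by (intro closed_Collect_conj closed_Collect_le continuous_intros)
  then have clR: "closure U \<subseteq> {z. r \<le> norm z \<and> norm z \<le> R}"
    by (intro closure_minimal) (auto simp: U_def)
  have cont: "continuous_on (closure U) \<psi>"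
    unfolding \<psi>_def
    by (intro continuous_intros continuous_on_V) (use clC clR r in auto)
  have bd: "bounded U" by (rule bounded_subset[OF bounded_cball[of 0 R]]) (auto simp: U_def)
  have lsc: "lsc_on (closure U) u"
    using u_lsc clC by (rule lsc_on_subset)
  define g where "g = (\<lambda>z. (z \<bullet> z) powr (\<alpha> / 2 - 1) *\<^sub>R ((\<alpha> * f (ang z)) *\<^sub>R z + f1 (ang z) *\<^sub>R rot z))"
  define H where "H = (\<lambda>z. polar_hessian \<alpha> (\<alpha> * (\<alpha> - 1) * f (ang z)) ((\<alpha> - 1) * f1 (ang z)) (f2 (ang z) + \<alpha> * f (ang z)) z)"
  have ang_U: "z \<noteq> 0" "\<bar>ang z\<bar> < G 1" if "z \<in> U" for z
    using that UC in_C by blast+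
  have "C2_with U V g H"
    unfolding V_def[abs_def] g_def H_def
  proof (rule C2_with_polar[where I = I])
    show "cplane z \<notin> \<real>\<^sub>\<le>\<^sub>0" if "z \<in> U" for z
      using ang_U[OF that] G1 by (intro cplane_not_nonpos_Reals) auto
    show "open I" by (simp add: I_def)
    show "ang ` U \<subseteq> I" using ang_U abs_le_G1 by force
  qed (use Uo DERIV_f DERIV_f1 continuous_on_f2 in blast)+
  from C2_with_scale_add_quadratic[OF this, of c e d]
  have C2: "C2_with U \<psi> (\<lambda>z. c *\<^sub>R g z + (2 * e) *\<^sub>R z) (\<lambda>z. c *\<^sub>R H z + mat (2 * e))"
    by (simp add: \<psi>_def)
  have pos: "pucci_minus lam Lam (c *\<^sub>R H z + mat (2 * e)) > 0" if "z \<in> U" for z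
    unfolding H_def
    by (rule pucci_minus_polar_hessian[OF ang_U(1)[OF that] f_trace f_det _ k lam c e])
      (use ellipticity n_sign in blast)
  show ?thesis
  proof (rule viscosity_comparison[OF bd viscosity_supersolution_subset[OF u_super UC] lsc _ C2 cont pos])
    show "u x \<noteq> - \<infinity>" if "x \<in> closure U" for x using u_nonneg[of x] that clC by auto
    show "ereal (\<psi> x) \<le> u x" if "x \<in> closure U - U" for x
    proof (rule bdry)
      show "norm x = r \<or> norm x = R \<or> x \<notin> C" using that clR by (auto simp: U_def)
    qed (use that clC clR in auto)
    show "z \<in> U" using z by (simp add: U_def)
  qed
qed

end

section \<open>Propagation of lower bounds\<close>

context cone_supersolution
begin

text \<open>On the circle V is r^\<alpha> times the profile, which is positive in the open cone and
  can be multiplied across. Evenness of \<open>f\<close> reconciles the signed angle with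
  \<open>polar_angle\<close>.\<close>

lemma circle_inf_ge_iff:
  assumes \<phi>: "\<And>t. 0 \<le> t \<Longrightarrow> t < G 1 \<Longrightarrow> \<phi> t = f t" and "c \<ge> 0" and "r > 0"
  shows "ereal (c * r powr \<alpha>) \<le> circle_inf (G 1) \<phi> u r \<longleftrightarrow>
    (\<forall>z\<in>C. norm z = r \<longrightarrow> ereal (c * V z) \<le> u z)"
proof -
  have "ereal (c * r powr \<alpha>) \<le> u z / ereal (\<phi> (polar_angle z)) \<longleftrightarrow> ereal (c * V z) \<le> u z"
    if z: "z \<in> C" "norm z = r" for z
  proof -
    have a: "z \<noteq> 0" "\<bar>ang z\<bar> < G 1" using z in_C by auto
    then have "\<phi> (polar_angle z) = f (ang z)"
      using \<phi>[of "\<bar>ang z\<bar>"] f_abs[OF abs_le_G1] by (simp add: polar_angle_eq_abs_ang)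
    moreover have "c * V z = f (ang z) * (c * r powr \<alpha>)"
      using z(2) by (simp add: V_def inner_self_powr_half)
    moreover have "ereal (c * r powr \<alpha>) \<le> u z / ereal (f (ang z)) \<longleftrightarrow>
        ereal (f (ang z) * (c * r powr \<alpha>)) \<le> u z"
      using f_pos[OF a(2)] by (simp add: ereal_le_divide_pos)
    ultimately show ?thesis by (simp only:)
  qed
  then show ?thesis
    unfolding circle_inf_def le_INF_iff by auto
qed

lemma circle_inf_nonneg:
  assumes \<phi>: "\<And>t. 0 \<le> t \<Longrightarrow> t < G 1 \<Longrightarrow> \<phi> t = f t" and "r > 0"
  shows "0 \<le> circle_inf (G 1) \<phi> u r"
proof -
  have "C \<subseteq> closure C" by (rule closure_subset)
  then show ?thesis
    using circle_inf_ge_iff[where c = 0 and \<phi> = \<phi> and r = r] assms u_nonneg by (auto simp: zero_ereal_def)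
qed

text \<open>The barriers \<open>c * V z + e * (norm z)\<^sup>2 + const\<close> are strict subsolutions below \<open>u\<close> on the boundary
  of a piece of the cone. Near the apex \<open>V\<close> vanishes if \<open>\<alpha> > 0\<close>, near infinity it tends to 0 if \<open>\<alpha> < 0\<close>.\<close>

lemma interior_bound:
  assumes "\<alpha> > 0" "c \<ge> 0" and R: "\<And>z. z \<in> C \<Longrightarrow> norm z = R \<Longrightarrow> ereal (c * V z) \<le> u z"
    and z: "z \<in> C" "norm z < R"
  shows "ereal (c * V z) \<le> u z"
proof (cases "u z")
  case (real w)
  have z0: "0 < norm z" using z in_C by simp
  \<comment> \<open>The constant makes the quadratic correction nonpositive up to radius R; at the
    apex and on the sides, V = 0 \<le> u.\<close>
  have *: "c * V z + e * (z \<bullet> z) + - e * R\<^sup>2 \<le> w" if e: "e > 0" for e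
  proof -
    have "ereal (c * V z + e * (z \<bullet> z) + - e * R\<^sup>2) \<le> u z"
    proof (rule annulus_comparison[where r = 0 and R = R])
      fix x assume x: "x \<in> closure C" "norm x \<le> R" "norm x = 0 \<or> norm x = R \<or> x \<notin> C"
      have "ereal (c * V x) \<le> u x"
        using x R[of x] V_boundary[of x] V_0 u_nonneg[of x] by (cases "x \<in> C") (auto simp: zero_ereal_def)
      moreover have "x \<bullet> x \<le> R\<^sup>2" using x(2) by (simp add: dot_square_norm power_mono)
      then have "c * V x + e * (x \<bullet> x) + - e * R\<^sup>2 \<le> c * V x" using e by simp
      ultimately show "ereal (c * V x + e * (x \<bullet> x) + - e * R\<^sup>2) \<le> u x"
        using order_trans ereal_less_eq(3) by blast
    qed (use assms e z0 in auto)
    then show ?thesis using real by simp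
  qed
  have "((\<lambda>e. c * V z + e * (z \<bullet> z) + - e * R\<^sup>2) \<longlongrightarrow> c * V z + 0 * (z \<bullet> z) + - 0 * R\<^sup>2) (at_right 0)"
    by (intro tendsto_intros)
  moreover have "eventually (\<lambda>e. c * V z + e * (z \<bullet> z) + - e * R\<^sup>2 \<le> w) (at_right 0)"
    using * by (auto simp: eventually_at_right_less eventually_at_filter intro!: always_eventually)
  ultimately have "c * V z + 0 * (z \<bullet> z) + - 0 * R\<^sup>2 \<le> w"
    by (rule tendsto_upperbound) simp
  then show ?thesis using real by simp
next
  case MInf
  then show ?thesis using u_nonneg[of z] z closure_subset by force
qed simp

lemma exterior_bound:
  assumes "\<alpha> < 0" "c \<ge> 0" and r: "r > 0" "\<And>z. z \<in> C \<Longrightarrow> norm z = r \<Longrightarrow> ereal (c * V z) \<le> u z"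
    and z: "z \<in> C" "norm z > r"
  shows "ereal (c * V z) \<le> u z"
proof (cases "u z")
  case (real w)
  obtain M where M: "M > 0" "\<And>x. x \<in> closure C \<Longrightarrow> \<bar>V x\<bar> \<le> M * norm x powr \<alpha>"
    using V_bounded by blast
  \<comment> \<open>On the outer arc only u \<ge> 0 is known; subtracting the bound
    \<open>c * (M * R powr \<alpha>)\<close> of c V makes the barrier nonpositive there.\<close>
  have *: "c * V z + e * (z \<bullet> z) + (- e * R\<^sup>2 - c * (M * R powr \<alpha>)) \<le> w" if e: "e > 0" and R: "R > norm z" for e R
  proof -
    have pos: "c * (M * R powr \<alpha>) \<ge> 0" using M(1) assms(2) by simp
    have "ereal (c * V z + e * (z \<bullet> z) + (- e * R\<^sup>2 - c * (M * R powr \<alpha>))) \<le> u z"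
    proof (rule annulus_comparison[where r = r and R = R])
      fix x assume x: "x \<in> closure C" "norm x \<le> R" "norm x = r \<or> norm x = R \<or> x \<notin> C"
      have "x \<bullet> x \<le> R\<^sup>2" using x(2) by (simp add: dot_square_norm power_mono)
      then have 1: "e * (x \<bullet> x) + - e * R\<^sup>2 \<le> 0" using e by simp
      show "ereal (c * V x + e * (x \<bullet> x) + (- e * R\<^sup>2 - c * (M * R powr \<alpha>))) \<le> u x"
      proof (cases "norm x = R \<or> x \<notin> C")
        case True
        have "c * V x \<le> c * (M * R powr \<alpha>)"
        proof (cases "x \<in> C")
          case True
          then have "V x \<le> M * R powr \<alpha>" using M(2)[OF x(1)] \<open>norm x = R \<or> x \<notin> C\<close> by auto
          then show ?thesis using assms(2) by (rule mult_left_mono)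
        qed (use V_boundary[OF x(1)] pos in simp)
        then have "c * V x + e * (x \<bullet> x) + (- e * R\<^sup>2 - c * (M * R powr \<alpha>)) \<le> 0" using 1 by simp
        moreover have "ereal 0 \<le> u x" using u_nonneg[OF x(1)] by (simp add: zero_ereal_def)
        ultimately show ?thesis using order_trans ereal_less_eq(3) by blast
      next
        case False
        then have "ereal (c * V x) \<le> u x" using x(3) r(2) by blast
        moreover have "c * V x + e * (x \<bullet> x) + (- e * R\<^sup>2 - c * (M * R powr \<alpha>)) \<le> c * V x" using 1 pos by simp
        ultimately show ?thesis using order_trans ereal_less_eq(3) by blast
      qed
    qed (use assms e R in auto)
    then show ?thesis using real by simp
  qed
  \<comment> \<open>The limit in e must precede the one in R: for fixed e the constant - e R^2 tends
    to minus infinity.\<close>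
  have **: "c * V z - c * (M * R powr \<alpha>) \<le> w" if R: "R > norm z" for R
  proof -
    have "((\<lambda>e. c * V z + e * (z \<bullet> z) + (- e * R\<^sup>2 - c * (M * R powr \<alpha>)))
      \<longlongrightarrow> c * V z + 0 * (z \<bullet> z) + (- 0 * R\<^sup>2 - c * (M * R powr \<alpha>))) (at_right 0)"
      by (intro tendsto_intros)
    moreover have "eventually (\<lambda>e. c * V z + e * (z \<bullet> z) + (- e * R\<^sup>2 - c * (M * R powr \<alpha>)) \<le> w) (at_right 0)"
      using *[OF _ R] by (auto simp: eventually_at_filter intro!: always_eventually)
    ultimately have "c * V z + 0 * (z \<bullet> z) + (- 0 * R\<^sup>2 - c * (M * R powr \<alpha>)) \<le> w"
      by (rule tendsto_upperbound) simp
    then show ?thesis by simp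
  qed
  have "((\<lambda>R. c * V z - c * (M * R powr \<alpha>)) \<longlongrightarrow> c * V z - c * (M * 0)) at_top"
    using assms(1) by (intro tendsto_intros tendsto_neg_powr filterlim_ident)
  moreover have "eventually (\<lambda>R. c * V z - c * (M * R powr \<alpha>) \<le> w) at_top"
    using eventually_gt_at_top[of "norm z"] by eventually_elim (rule **)
  ultimately have "c * V z - c * (M * 0) \<le> w" by (rule tendsto_upperbound) simp
  then show ?thesis using real by simp
next
  case MInf
  then show ?thesis using u_nonneg[of z] z closure_subset by force
qed simp

text \<open>Propagation from radius q to radius r, in either order, so that it serves both claims.
  If the inequality failed, a real c strictly between the two sides would bound u on circle q, hence
  by \<open>bound\<close> on circle r, contradicting its choice. It is nonnegative because the
  smaller side is.\<close>

lemma scaled_circle_inf_le: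
  assumes \<phi>: "\<And>t. 0 \<le> t \<Longrightarrow> t < G 1 \<Longrightarrow> \<phi> t = f t" and r: "r > 0" "q > 0"
    and bound: "\<And>c z. c \<ge> 0 \<Longrightarrow> (\<And>z. z \<in> C \<Longrightarrow> norm z = q \<Longrightarrow> ereal (c * V z) \<le> u z)
      \<Longrightarrow> z \<in> C \<Longrightarrow> norm z = r \<Longrightarrow> ereal (c * V z) \<le> u z"
  shows "ereal (q powr (- \<alpha>)) * circle_inf (G 1) \<phi> u q \<le> ereal (r powr (- \<alpha>)) * circle_inf (G 1) \<phi> u r"
    (is "?q \<le> ?r")
proof (rule ccontr)
  assume "\<not> ?q \<le> ?r"
  then obtain c where c: "?r < ereal c" "ereal c < ?q" using ereal_dense2 not_le by metis
  have le_iff: "ereal c \<le> ereal (p powr (- \<alpha>)) * m \<longleftrightarrow> ereal (c * p powr \<alpha>) \<le> m" if "p > 0" for p m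
  proof (cases m)
    case (real m')
    then show ?thesis using that by (simp add: powr_minus field_simps)
  qed (use that in auto)
  have "0 \<le> ?r" using circle_inf_nonneg[OF \<phi> r(1)] by (simp add: ereal_zero_le_0_iff)
  from le_less_trans[OF this c(1)] have "0 < ereal c" .
  then have c0: "c \<ge> 0" by simp
  have "ereal (c * q powr \<alpha>) \<le> circle_inf (G 1) \<phi> u q"
    using c(2) le_iff[OF r(2)] less_imp_le by blast
  then have q: "ereal (c * V z) \<le> u z" if "z \<in> C" "norm z = q" for z
    using circle_inf_ge_iff[OF \<phi> c0 r(2)] that by blast
  have "ereal (c * r powr \<alpha>) \<le> circle_inf (G 1) \<phi> u r"
  proof (rule circle_inf_ge_iff[THEN iffD2, OF _ c0 r(1)])
    show "\<forall>z\<in>C. norm z = r \<longrightarrow> ereal (c * V z) \<le> u z"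
    proof (intro ballI impI)
      fix z assume "z \<in> C" "norm z = r"
      with q show "ereal (c * V z) \<le> u z" by (rule bound[OF c0])
    qed
  qed (rule \<phi>)
  then have "ereal c \<le> ?r" using le_iff[OF r(1)] by blast
  then show False using c(1) by simp
qed

lemma antimono_scaled_circle_inf:
  assumes \<phi>: "\<And>t. 0 \<le> t \<Longrightarrow> t < G 1 \<Longrightarrow> \<phi> t = f t" and "\<alpha> > 0"
  shows "antimono_on {0<..} (\<lambda>r. ereal (r powr (- \<alpha>)) * circle_inf (G 1) \<phi> u r)"
proof (rule monotone_onI)
  fix r q :: real assume *: "r \<in> {0<..}" "q \<in> {0<..}" "r \<le> q"
  show "ereal (q powr (- \<alpha>)) * circle_inf (G 1) \<phi> u q \<le> ereal (r powr (- \<alpha>)) * circle_inf (G 1) \<phi> u r"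
  proof (cases "r = q")
    case False
    show ?thesis
    proof (rule scaled_circle_inf_le[OF \<phi>])
      fix c z assume "c \<ge> 0" "\<And>z. z \<in> C \<Longrightarrow> norm z = q \<Longrightarrow> ereal (c * V z) \<le> u z" "z \<in> C" "norm z = r"
      then show "ereal (c * V z) \<le> u z"
        using * False by - (rule interior_bound[OF assms(2), where R = q], simp_all)
    qed (use * in simp_all)
  qed simp
qed

lemma mono_scaled_circle_inf:
  assumes \<phi>: "\<And>t. 0 \<le> t \<Longrightarrow> t < G 1 \<Longrightarrow> \<phi> t = f t" and "\<alpha> < 0"
  shows "mono_on {0<..} (\<lambda>r. ereal (r powr (- \<alpha>)) * circle_inf (G 1) \<phi> u r)"
proof (rule monotone_onI)
  fix r q :: real assume *: "r \<in> {0<..}" "q \<in> {0<..}" "r \<le> q"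
  show "ereal (r powr (- \<alpha>)) * circle_inf (G 1) \<phi> u r \<le> ereal (q powr (- \<alpha>)) * circle_inf (G 1) \<phi> u q"
  proof (cases "r = q")
    case False
    show ?thesis
    proof (rule scaled_circle_inf_le[OF \<phi>])
      fix c z assume "c \<ge> 0" "\<And>z. z \<in> C \<Longrightarrow> norm z = r \<Longrightarrow> ereal (c * V z) \<le> u z" "z \<in> C" "norm z = q"
      then show "ereal (c * V z) \<le> u z"
        using * False by - (rule exterior_bound[OF assms(2), where r = r], simp_all)
    qed (use * in simp_all)
  qed simp
qed

end

section \<open>The two exponents\<close>

context profile
begin

lemma G_inv_eq:
  assumes "0 \<le> t" "t < G 1" shows "inv_into {0..1} G t = Xi t"
proof -
  have t: "t \<in> I" using assms abs_le_G1 by simp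
  have "G 0 \<le> G (Xi t)" "G (Xi t) < G 1" using assms by (auto simp: G_Xi[OF t] G_0)
  then have "Xi t \<in> {0..1}"
    using strict_mono_less_eq[OF strict_mono_G] strict_mono_less[OF strict_mono_G] by auto
  then show ?thesis
    using inv_into_f_f[of G "{0..1}" "Xi t"] inj_G G_Xi[OF t] by (simp add: inj_on_subset[OF inj_G])
qed

end

lemma arctan_add_arctan_inverse: "x > 0 \<Longrightarrow> arctan x + arctan (1 / x) = pi / 2"
  using arctan_inverse[of x] by (simp add: inverse_eq_divide)

text \<open>The case split of \<open>G_fun\<close> at \<open>\<alpha> = 1\<close> has to match that of \<open>phi_plus\<close> at \<open>\<theta>0 = \<pi>/2\<close>. This follows by
  comparing the opening \<open>G 1\<close> of the cone with the one for \<open>\<alpha> = 1\<close>.\<close>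

lemma profile_G1_at_1:
  assumes k: "k > 0" shows "profile k 1 1" "profile.G k 1 1 1 = pi / 2"
proof -
  show p: "profile k 1 1" by standard (use k in auto)
  interpret profile k 1 1 by (rule p)
  have "arctan (sqrt k) + arctan (1 / sqrt k) = pi / 2" using k by (intro arctan_add_arctan_inverse) simp
  moreover have "A * B = 1" "k * A / B = 1 / k" using k by (simp_all add: A_def B_def)
  ultimately show "G 1 = pi / 2"
    unfolding G_def by (simp only:) (simp add: real_sqrt_divide)
qed

text \<open>\<alpha> enters \<open>G'\<close> only through the factor B + k A x^2 of the
  denominator, which increases with \<alpha>.\<close>

lemma G'_antimono:
  assumes p: "profile k \<alpha> 1" "profile k \<beta> 1" and "\<alpha> < \<beta>"
  shows "profile.G' k \<beta> 1 x < profile.G' k \<alpha> 1 x"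
proof -
  interpret a: profile k \<alpha> 1 by (rule p)
  interpret b: profile k \<beta> 1 by (rule p)
  have "a.B + k * a.A * x\<^sup>2 < b.B + k * b.A * x\<^sup>2"
    unfolding a.kA b.kA a.B_def b.B_def using assms(3) a.k
    by (intro add_less_le_mono mult_right_mono) auto
  then show ?thesis
    unfolding a.G'_def b.G'_def using a.denom_pos[of x] b.denom_pos[of x] a.k
    by (intro divide_strict_left_mono mult_strict_left_mono mult_pos_pos) (auto intro: add_pos_nonneg)
qed

lemma G1_antimono:
  assumes p: "profile k \<alpha> 1" "profile k \<beta> 1" and "\<alpha> < \<beta>"
  shows "profile.G k \<beta> 1 1 < profile.G k \<alpha> 1 1"
proof -
  interpret a: profile k \<alpha> 1 by (rule p)
  interpret b: profile k \<beta> 1 by (rule p)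
  have "a.G 0 - b.G 0 < a.G 1 - b.G 1"
  proof (rule DERIV_pos_imp_increasing[where f = "\<lambda>x. a.G x - b.G x"])
    fix x :: real assume "0 \<le> x" "x \<le> 1"
    have "((\<lambda>x. a.G x - b.G x) has_real_derivative a.G' x - b.G' x) (at x)"
      by (intro DERIV_diff a.DERIV_G b.DERIV_G)
    moreover have "a.G' x - b.G' x > 0" using G'_antimono[OF assms, of x] by simp
    ultimately show "\<exists>y. ((\<lambda>x. a.G x - b.G x) has_real_derivative y) (at x) \<and> y > 0" by blast
  qed simp
  then show ?thesis using a.G_0 b.G_0 by simp
qed

lemma phi1_eq:
  assumes p: "profile \<omega> \<alpha> s" and G: "G_fun \<omega> \<alpha> = profile.G \<omega> \<alpha> s"
    and t: "0 \<le> t" "t < profile.G \<omega> \<alpha> s 1"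
  shows "phi1 \<omega> \<alpha> t = profile.f \<omega> \<alpha> s t"
proof -
  interpret profile \<omega> \<alpha> s by (rule p)
  have "G_inv \<omega> \<alpha> t = Xi t" unfolding G_inv_def G by (rule G_inv_eq[OF t])
  moreover have "A_coef \<omega> \<alpha> = A" "B_coef \<omega> \<alpha> = B"
    by (simp_all add: A_def B_def A_coef_def B_coef_def)
  ultimately show ?thesis
    by (simp only: phi1_def f_def F0_def Q_def Let_def powr_minus_divide) simp
qed

lemma phi2_eq:
  assumes p: "profile (1 / \<omega>) \<alpha> s" and G: "G_fun \<omega> \<alpha> = profile.G (1 / \<omega>) \<alpha> s"
    and t: "0 \<le> t" "t < profile.G (1 / \<omega>) \<alpha> s 1"
  shows "phi2 \<omega> \<alpha> t = profile.f (1 / \<omega>) \<alpha> s t"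
proof -
  interpret profile "1 / \<omega>" \<alpha> s by (rule p)
  have "G_inv \<omega> \<alpha> t = Xi t" unfolding G_inv_def G by (rule G_inv_eq[OF t])
  moreover have "A_coef \<omega> \<alpha> = B" "B_coef \<omega> \<alpha> = A"
    by (simp_all add: A_def B_def A_coef_def B_coef_def)
  ultimately show ?thesis
    by (simp only: phi2_def f_def F0_def Q_def Let_def powr_minus_divide) simp
qed

lemma G_fun_eq_1:
  assumes p: "profile \<omega> \<alpha> s" and "\<alpha> \<ge> 1 \<and> s = 1 \<or> \<alpha> < 1 \<and> \<not> 1 - 1 / \<omega> < \<alpha> \<and> s = - 1"
  shows "G_fun \<omega> \<alpha> = profile.G \<omega> \<alpha> s"
proof -
  interpret profile \<omega> \<alpha> s by (rule p)
  have "A_coef \<omega> \<alpha> = A" "B_coef \<omega> \<alpha> = B" by (simp_all add: A_def B_def A_coef_def B_coef_def)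
  then show ?thesis using assms(2) by (auto simp: fun_eq_iff G_fun_def G_def Let_def)
qed

lemma G_fun_eq_2:
  assumes p: "profile (1 / \<omega>) \<alpha> 1" and "\<alpha> < 1" "1 - 1 / \<omega> < \<alpha>"
  shows "G_fun \<omega> \<alpha> = profile.G (1 / \<omega>) \<alpha> 1"
proof -
  interpret profile "1 / \<omega>" \<alpha> 1 by (rule p)
  have "A_coef \<omega> \<alpha> = B" "B_coef \<omega> \<alpha> = A"
    by (simp_all add: A_def B_def A_coef_def B_coef_def)
  then show ?thesis using assms(2,3)
    by (simp add: fun_eq_iff G_fun_def G_def Let_def real_sqrt_divide mult.commute)
qed

theorem theorem3p1:
  fixes lam Lam \<omega> \<theta>0 \<alpha>m \<alpha>p :: real
    and u :: "real^2 \<Rightarrow> ereal"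
  assumes "0 < lam" and "lam \<le> Lam" and "\<omega> = Lam / lam"
    and "\<theta>0 \<in> {0<..<pi}"
    and "\<alpha>m \<in> exponent_dom \<omega>" and "\<alpha>m < 0" and "g_fun \<omega> \<alpha>m = \<theta>0"
    and "\<alpha>p \<in> exponent_dom \<omega>" and "\<alpha>p > 0" and "g_fun \<omega> \<alpha>p = \<theta>0"
    and "\<forall>z \<in> closure (cone_C0 \<theta>0). 0 \<le> u z"
    and "lsc_on (closure (cone_C0 \<theta>0)) u"
    and "viscosity_supersolution (pucci_minus lam Lam) (cone_C0 \<theta>0) u"
  shows "antimono_on {0<..} (\<lambda>r. ereal (r powr (- \<alpha>p)) * circle_inf \<theta>0 (phi_plus \<omega> \<theta>0 \<alpha>p) u r)
    \<and> mono_on {0<..} (\<lambda>r. ereal (r powr (- \<alpha>m)) * circle_inf \<theta>0 (phi_minus \<omega> \<alpha>m) u r)"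
proof
  have \<omega>: "\<omega> \<ge> 1" "\<omega> * lam = Lam" "1 / \<omega> * Lam = lam" "1 / \<omega> > 0" "1 / \<omega> \<le> 1"
    using assms(1-3) by (auto simp: field_simps)
  have super: "cone_supersolution k \<alpha> s lam Lam u"
    if "profile k \<alpha> s" "profile.G k \<alpha> s 1 = \<theta>0"
      "\<alpha> * (\<alpha> - 1) \<ge> 0 \<and> k * lam = Lam \<or> \<alpha> * (\<alpha> - 1) \<le> 0 \<and> k * Lam = lam" for k \<alpha> s
    using that assms by (auto simp: cone_supersolution_def cone_supersolution_axioms_def)
  have p1: "profile \<omega> \<alpha> 1" "profile (1 / \<omega>) \<alpha> 1" if "\<alpha> > 1 - 1 / \<omega>" for \<alpha>
  proof -
    have "\<alpha> > 0" "\<alpha> - 1 + \<omega> > 0" "\<alpha> - 1 + 1 / \<omega> > 0" using that \<omega>(1,5) by linarith+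
    then show "profile \<omega> \<alpha> 1" "profile (1 / \<omega>) \<alpha> 1" using \<omega>(1,4) by (simp_all add: profile_def)
  qed
  show "antimono_on {0<..} (\<lambda>r. ereal (r powr (- \<alpha>p)) * circle_inf \<theta>0 (phi_plus \<omega> \<theta>0 \<alpha>p) u r)"
  proof (cases "\<alpha>p \<ge> 1")
    case True
    have p: "profile \<omega> \<alpha>p 1" by (rule p1(1)) (use True \<omega>(4) in linarith)
    have G: "G_fun \<omega> \<alpha>p = profile.G \<omega> \<alpha>p 1" using G_fun_eq_1[OF p] True by simp
    have total: "profile.G \<omega> \<alpha>p 1 1 = \<theta>0" using assms(10) G by (simp add: g_fun_def)
    \<comment> \<open>At \<alpha> = 1 the opening is exactly \<pi>/2, and it decreases in
      \<alpha>.\<close>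
    have "\<theta>0 \<le> pi / 2"
      using G1_antimono[of \<omega> 1 \<alpha>p] p profile_G1_at_1[of \<omega>] True \<omega>(1) total by (cases "\<alpha>p = 1") auto
    then have phi: "phi_plus \<omega> \<theta>0 \<alpha>p = phi1 \<omega> \<alpha>p" by (simp add: phi_plus_def)
    interpret cone_supersolution \<omega> \<alpha>p 1 lam Lam u
      using super[OF p total] True \<omega>(2) by simp
    show ?thesis
      unfolding phi unfolding total[symmetric] by (rule antimono_scaled_circle_inf[OF phi1_eq[OF p G] assms(9)])
  next
    case False
    \<comment> \<open>As 1 - \<omega> \<le> 0, a positive exponent lies in the upper half of
      \<open>exponent_dom\<close>.\<close>
    then have \<alpha>p: "\<alpha>p > 1 - 1 / \<omega>" using assms(8,9) \<omega> by (auto simp: exponent_dom_def)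
    have p: "profile (1 / \<omega>) \<alpha>p 1" using p1(2) \<alpha>p by simp
    have G: "G_fun \<omega> \<alpha>p = profile.G (1 / \<omega>) \<alpha>p 1" using G_fun_eq_2[OF p] False \<alpha>p by simp
    have total: "profile.G (1 / \<omega>) \<alpha>p 1 1 = \<theta>0" using assms(10) G by (simp add: g_fun_def)
    have "\<theta>0 > pi / 2"
      using G1_antimono[of "1 / \<omega>" \<alpha>p 1] p profile_G1_at_1[of "1 / \<omega>"] False \<omega>(4) total by auto
    then have phi: "phi_plus \<omega> \<theta>0 \<alpha>p = phi2 \<omega> \<alpha>p" by (simp add: phi_plus_def)
    \<comment> \<open>For 0 < \<alpha> < 1 the product \<alpha>(\<alpha> - 1) is negative, which
      calls for k = 1/\<omega>.\<close>
    interpret cone_supersolution "1 / \<omega>" \<alpha>p 1 lam Lam u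
      using super[OF p total] False assms(9) \<omega>(3) by (simp add: mult_nonneg_nonpos)
    show ?thesis
      unfolding phi unfolding total[symmetric] by (rule antimono_scaled_circle_inf[OF phi2_eq[OF p G] assms(9)])
  qed
  \<comment> \<open>As 1 - 1/\<omega> \<ge> 0, a negative exponent lies in the lower half, where
    both coefficients are negative and s = -1.\<close>
  have \<alpha>m: "\<alpha>m < 1 - \<omega>" using assms(5,6) \<omega> by (auto simp: exponent_dom_def)
  have p: "profile \<omega> \<alpha>m (- 1)" 
  proof -
    have "\<alpha>m - 1 + 1 / \<omega> < 0" "\<alpha>m - 1 + \<omega> < 0" using \<alpha>m \<omega>(1,5) by linarith+
    then show ?thesis using assms(6) \<omega>(1) unfolding profile_def by simp
  qed
  have G: "G_fun \<omega> \<alpha>m = profile.G \<omega> \<alpha>m (- 1)" using G_fun_eq_1[OF p] \<alpha>m \<omega> by simp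
  have total: "profile.G \<omega> \<alpha>m (- 1) 1 = \<theta>0" using assms(7) G by (simp add: g_fun_def)
  interpret cone_supersolution \<omega> \<alpha>m "- 1" lam Lam u
    using super[OF p total] assms(6) \<omega>(2) by (simp add: mult_nonpos_nonpos)
  show "mono_on {0<..} (\<lambda>r. ereal (r powr (- \<alpha>m)) * circle_inf \<theta>0 (phi_minus \<omega> \<alpha>m) u r)"
    unfolding phi_minus_def total[symmetric] by (rule mono_scaled_circle_inf[OF phi1_eq[OF p G] assms(6)])
qed

end
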